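(* There is a polynomial-time 2-approximation algorithm for the School Bus Routing problem on trees: given an instance, it outputs a feasible collection of paths whose number is at most twice the minimum possible number.
   Context: School Bus Routing on a tree: the input is a tree $T=(V,E)$ rooted at a depot $r$, nonnegative edge lengths $\ell(u,v)$, a set of clients located at vertices of $T$, and a regret bound $R\ge0$. A feasible solution is a collection of paths (walks in $T$), each starting at $r$ and each of regret at most $R$, such that every client lies on at least one path; the goal is to minimize the number of paths. The length $\ell(P)$ of a walk $P$ is the total length of the edges it traverses (with multiplicity), and the regret of a walk $P$ from $u$ to $v$ is $\ell(P)-d_T(u,v)$, where $d_T$ is the shortest-path distance in $T$. *)

theory Defs
  imports
    "Graph_Theory.Graph_Theory"
    "HOL-Library.Log_Nat"
    "HOL-Computational_Algebra.Polynomial"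
begin

section \<open>School Bus Routing on trees\<close>

text \<open>
  A finite simple undirected graph is a \<^locale>\<open>pair_graph\<close>: each edge is represented by its two
  opposite arcs. The library's predicates forest and tree cannot be used for such graphs, since
  they count the traversal of an edge back and forth as a cycle. The cycles of the underlying
  undirected graph are exactly the library's cycles with at least three arcs.
\<close>

locale school_bus_tree = pair_graph T for T :: "'v pair_pre_digraph" +
  fixes len :: "'v \<times> 'v \<Rightarrow> real"
    and depot :: 'v
    and clients :: "'v set"
    and bound :: real
  assumes connected: "Digraph_Component.connected (with_proj T)"
    and acyclic: "\<nexists>p. cycle p \<and> 3 \<le> length p"
    and len_sym: "(u, v) \<in> parcs T \<Longrightarrow> len (u, v) = len (v, u)"
    and len_nonneg: "e \<in> parcs T \<Longrightarrow> 0 \<le> len e"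
    and depot_in_verts: "depot \<in> pverts T"
    and clients_in_verts: "clients \<subseteq> pverts T"
    and bound_nonneg: "0 \<le> bound"
begin

definition regret :: "'v \<Rightarrow> ('v \<times> 'v) awalk \<Rightarrow> 'v \<Rightarrow> ereal" where
  "regret u p v = ereal (awalk_cost len p) - \<mu> len u v"

text \<open>
  Solutions are lists, so that their number of walks is the length, with multiplicity. A walk is
  the list of its arcs; the empty list is the walk that stays at the depot.
\<close>

definition feasible :: "('v \<times> 'v) awalk list \<Rightarrow> bool" where
  "feasible ps \<longleftrightarrow>
     (\<forall>p \<in> set ps. \<exists>v. awalk depot p v \<and> regret depot p v \<le> ereal bound) \<and>
     (\<forall>c \<in> clients. \<exists>p \<in> set ps. c \<in> set (awalk_verts depot p))"

definition opt :: nat where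
  "opt = Inf {length ps | ps. feasible ps}"

end


section \<open>A model of polynomial-time computation\<close>

text \<open>
  Programs are first-order call-by-value recursive programs over trees with integer leaves.
  A program is a list of bodies of one-argument functions; \<open>Call f e\<close> refers to function number
  \<open>f\<close>, and variables are de Bruijn indices. Costs are logarithmic: every evaluation step is
  charged one plus the bit size of its result (operands are charged when they are themselves
  evaluated). Hence all intermediate values, and the output, have size at most the running time,
  and polynomial time in this model is polynomial time on Turing machines.
\<close>

datatype val = VInt int | VPair val val

fun vsize :: "val \<Rightarrow> nat" where
  "vsize (VInt i) = 1 + floorlog 2 (nat \<bar>i\<bar>)"
| "vsize (VPair a b) = 1 + vsize a + vsize b"

datatype exp =
    Var nat
  | Const int
  | CONS exp exp
  | Fst exp
  | Snd exp
  | IsPair exp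
  | Add exp exp
  | Sub exp exp
  | Mul exp exp
  | Leq exp exp
  | IF exp exp exp
  | LET exp exp
  | Call nat exp

type_synonym prog = "exp list"

inductive eval :: "prog \<Rightarrow> val list \<Rightarrow> exp \<Rightarrow> val \<Rightarrow> nat \<Rightarrow> bool" for P where
  Var: "i < length \<rho> \<Longrightarrow> eval P \<rho> (Var i) (\<rho> ! i) (1 + vsize (\<rho> ! i))"
| Const: "eval P \<rho> (Const n) (VInt n) (1 + vsize (VInt n))"
| CONS: "eval P \<rho> e a s \<Longrightarrow> eval P \<rho> e' b t \<Longrightarrow>
    eval P \<rho> (CONS e e') (VPair a b) (s + t + 1 + vsize (VPair a b))"
| Fst: "eval P \<rho> e (VPair a b) t \<Longrightarrow> eval P \<rho> (Fst e) a (t + 1 + vsize a)"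
| Snd: "eval P \<rho> e (VPair a b) t \<Longrightarrow> eval P \<rho> (Snd e) b (t + 1 + vsize b)"
| IsPair_True: "eval P \<rho> e (VPair a b) t \<Longrightarrow>
    eval P \<rho> (IsPair e) (VInt 1) (t + 1 + vsize (VInt 1))"
| IsPair_False: "eval P \<rho> e (VInt n) t \<Longrightarrow>
    eval P \<rho> (IsPair e) (VInt 0) (t + 1 + vsize (VInt 0))"
| Add: "eval P \<rho> e (VInt m) s \<Longrightarrow> eval P \<rho> e' (VInt n) t \<Longrightarrow>
    eval P \<rho> (Add e e') (VInt (m + n)) (s + t + 1 + vsize (VInt (m + n)))"
| Sub: "eval P \<rho> e (VInt m) s \<Longrightarrow> eval P \<rho> e' (VInt n) t \<Longrightarrow>
    eval P \<rho> (Sub e e') (VInt (m - n)) (s + t + 1 + vsize (VInt (m - n)))"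
| Mul: "eval P \<rho> e (VInt m) s \<Longrightarrow> eval P \<rho> e' (VInt n) t \<Longrightarrow>
    eval P \<rho> (Mul e e') (VInt (m * n)) (s + t + 1 + vsize (VInt (m * n)))"
| Leq: "eval P \<rho> e (VInt m) s \<Longrightarrow> eval P \<rho> e' (VInt n) t \<Longrightarrow>
    eval P \<rho> (Leq e e') (VInt (of_bool (m \<le> n))) (s + t + 1 + vsize (VInt (of_bool (m \<le> n))))"
| IF_True: "eval P \<rho> c (VInt n) s \<Longrightarrow> n \<noteq> 0 \<Longrightarrow> eval P \<rho> e v t \<Longrightarrow>
    eval P \<rho> (IF c e e') v (s + t + 1 + vsize v)"
| IF_False: "eval P \<rho> c (VInt 0) s \<Longrightarrow> eval P \<rho> e' v t \<Longrightarrow>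
    eval P \<rho> (IF c e e') v (s + t + 1 + vsize v)"
| LET: "eval P \<rho> e a s \<Longrightarrow> eval P (a # \<rho>) e' v t \<Longrightarrow>
    eval P \<rho> (LET e e') v (s + t + 1 + vsize v)"
| Call: "eval P \<rho> e a s \<Longrightarrow> f < length P \<Longrightarrow> eval P [a] (P ! f) v t \<Longrightarrow>
    eval P \<rho> (Call f e) v (s + t + 1 + vsize v)"

inductive_cases eval_elims:
  "eval P \<rho> (Var i) v t"
  "eval P \<rho> (Const n) v t"
  "eval P \<rho> (CONS e e') v t"
  "eval P \<rho> (Fst e) v t"
  "eval P \<rho> (Snd e) v t"
  "eval P \<rho> (IsPair e) v t"
  "eval P \<rho> (Add e e') v t"
  "eval P \<rho> (Sub e e') v t"
  "eval P \<rho> (Mul e e') v t"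
  "eval P \<rho> (Leq e e') v t"
  "eval P \<rho> (IF c e e') v t"
  "eval P \<rho> (LET e e') v t"
  "eval P \<rho> (Call f e) v t"

lemma eval_deterministic:
  "eval P \<rho> e v t \<Longrightarrow> eval P \<rho> e v' t' \<Longrightarrow> v' = v \<and> t' = t"
proof (induction arbitrary: v' t' rule: eval.induct)
  case Var
  from Var.prems show ?case by (rule eval_elims) simp
next
  case Const
  from Const.prems show ?case by (rule eval_elims) simp
next
  case CONS
  from CONS.prems show ?case by (rule eval_elims) (auto dest!: CONS.IH simp: vsize.simps)
next
  case Fst
  from Fst.prems show ?case by (rule eval_elims) (auto dest!: Fst.IH simp: vsize.simps)
next
  case Snd
  from Snd.prems show ?case by (rule eval_elims) (auto dest!: Snd.IH simp: vsize.simps)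
next
  case IsPair_True
  from IsPair_True.prems show ?case by (rule eval_elims) (auto dest!: IsPair_True.IH simp: vsize.simps)
next
  case IsPair_False
  from IsPair_False.prems show ?case by (rule eval_elims) (auto dest!: IsPair_False.IH simp: vsize.simps)
next
  case Add
  from Add.prems show ?case by (rule eval_elims) (auto dest!: Add.IH simp: vsize.simps)
next
  case Sub
  from Sub.prems show ?case by (rule eval_elims) (auto dest!: Sub.IH simp: vsize.simps)
next
  case Mul
  from Mul.prems show ?case by (rule eval_elims) (auto dest!: Mul.IH simp: vsize.simps)
next
  case Leq
  from Leq.prems show ?case by (rule eval_elims) (auto dest!: Leq.IH simp: vsize.simps)
next
  case IF_True
  from IF_True.prems show ?case by (rule eval_elims) (auto dest!: IF_True.IH simp: IF_True.hyps)
next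
  case IF_False
  from IF_False.prems show ?case by (rule eval_elims) (auto dest!: IF_False.IH simp: vsize.simps)
next
  case LET
  from LET.prems show ?case by (rule eval_elims) (auto dest!: LET.IH simp: vsize.simps)
next
  case Call
  from Call.prems show ?case by (rule eval_elims) (auto dest!: Call.IH simp: Call.hyps)
qed

text \<open>Execution starts with function number 0.\<close>

definition runs_in :: "prog \<Rightarrow> val \<Rightarrow> val \<Rightarrow> nat \<Rightarrow> bool" where
  "runs_in P x y t \<longleftrightarrow> eval P [x] (Call 0 (Var 0)) y t"

definition polytime_on :: "prog \<Rightarrow> val set \<Rightarrow> bool" where
  "polytime_on P X \<longleftrightarrow>
     (\<exists>q :: nat poly. \<forall>x \<in> X. \<exists>y t. runs_in P x y t \<and> t \<le> poly q (vsize x))"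

definition computes :: "prog \<Rightarrow> val \<Rightarrow> val \<Rightarrow> bool" where
  "computes P x y \<longleftrightarrow> (\<exists>t. runs_in P x y t)"


section \<open>Encoding of instances and solutions\<close>

definition enc_nat :: "nat \<Rightarrow> val" where
  "enc_nat n = VInt (int n)"

definition enc_rat :: "rat \<Rightarrow> val" where
  "enc_rat q = VPair (VInt (fst (quotient_of q))) (VInt (snd (quotient_of q)))"

definition enc_pair :: "('a \<Rightarrow> val) \<Rightarrow> ('b \<Rightarrow> val) \<Rightarrow> 'a \<times> 'b \<Rightarrow> val" where
  "enc_pair f g x = VPair (f (fst x)) (g (snd x))"

definition enc_list :: "('a \<Rightarrow> val) \<Rightarrow> 'a list \<Rightarrow> val" where
  "enc_list f xs = foldr (\<lambda>x. VPair (f x)) xs (VInt 0)"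

text \<open>
  Vertices are natural numbers in binary. An instance is given by repetition-free listings, in an
  arbitrary order, of its vertices, its arcs with their lengths (each edge is listed in both
  directions) and its client locations, together with the depot and the regret bound. Only
  instances with rational data have an encoding.
\<close>

definition encodes_instance ::
  "nat pair_pre_digraph \<Rightarrow> (nat \<times> nat \<Rightarrow> real) \<Rightarrow> nat \<Rightarrow> nat set \<Rightarrow> real \<Rightarrow> val \<Rightarrow> bool" where
  "encodes_instance T len depot clients bound x \<longleftrightarrow>
     (\<exists>vs as cs b.
        distinct vs \<and> set vs = pverts T \<and>
        distinct (map fst as) \<and> set (map fst as) = parcs T \<and>
        (\<forall>(e, l) \<in> set as. len e = real_of_rat l) \<and>
        distinct cs \<and> set cs = clients \<and>
        bound = real_of_rat b \<and>
        x = VPair (enc_list enc_nat vs)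
             (VPair (enc_list (enc_pair (enc_pair enc_nat enc_nat) enc_rat) as)
               (VPair (enc_nat depot)
                 (VPair (enc_list enc_nat cs) (enc_rat b)))))"

definition enc_solution :: "(nat \<times> nat) awalk list \<Rightarrow> val" where
  "enc_solution = enc_list (enc_list (enc_pair enc_nat enc_nat))"

end

theory Submission
  imports Defs
begin

text \<open>
  Root the tree at the depot and let \<open>\<delta>(x, y)\<close> be the distance from \<open>x\<close> up to the lowest common
  ancestor of \<open>x\<close> and \<open>y\<close>. A walk that goes straight to \<open>l\<^sub>1\<close> and then visits \<open>l\<^sub>2, \<dots>, l\<^sub>k\<close> in turn
  has regret \<open>2 \<Sum> \<delta>(l\<^sub>i, l\<^sub>i\<^sub>+\<^sub>1)\<close>. Insert the clients, the deepest ones first, into a list, each just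
  before the first list element that minimises its \<open>\<delta>\<close>; then cut the list greedily into walks of
  regret at most \<open>R\<close>.

  Scale lengths to integers and let \<open>D = \<lfloor>R/2\<rfloor> + 1\<close>. Consecutive walks of the output account for at
  least \<open>D\<close> in \<open>\<Sum> min(\<delta>, D)\<close>, and an insertion raises this sum by \<open>min(m, D)\<close>, where \<open>m\<close> is the length of
  the newly covered path. Charge each arc of the tree spanned by the clients with the part of its
  length that lies less than \<open>D\<close> above the deepest client below it. A walk of regret at most \<open>R\<close> that
  ends in \<open>v\<close> covers arcs on the path to \<open>v\<close>, with total charge at most \<open>D\<close>, and others, which it
  traverses twice and which therefore have total length at most \<open>R/2 < D\<close>. Hence \<open>n\<close> walks cover
  charges of less than \<open>2nD\<close>, while the output of \<open>N\<close> walks needs at least \<open>(N - 1)D\<close>.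

  Polynomial running time is obtained from closure properties of a class of functions on encoded
  data, whose only recursion scheme is list recursion with polynomially bounded values.
\<close>

section \<open>Polynomial bounds\<close>

text \<open>Why an insertion adds one term: placing \<open>c\<close> between \<open>a\<close> and
  \<open>l\<close> redirects the climb out of \<open>a\<close> and adds a climb out of
  \<open>c\<close>. Depths of lowest common ancestors satisfy the ultrametric inequality, and
  \<open>a\<close>, which stands before the first minimiser, branches off from \<open>c\<close>
  strictly higher than \<open>l\<close> does. So the climb out of \<open>a\<close> keeps its value.
  Why deepest first: an arc becomes covered by the deepest client below it, so its charge is final
  from that moment on, and the increase of the cost can be compared with the charges of the new arcs
  alone. Why a cap: a walk covers the path to its end without regret, however long that path is.
  Capping keeps this free part comparable to the cost of a cut. Why integers: a cost above
  \<open>R/2\<close> is at least \<open>D\<close>, while the edges off the path to the end have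
  total length at most \<open>D - 1\<close>. This unit makes the final comparison strict; without it
  the count would only give \<open>2n + 1\<close> walks.\<close>

definition polyb :: "(nat \<Rightarrow> nat) \<Rightarrow> bool" where
  "polyb f \<longleftrightarrow> (\<exists>k. \<forall>n. f n \<le> (n + 2) ^ k)"

lemma polyb_mono: "polyb g \<Longrightarrow> (\<And>n. f n \<le> g n) \<Longrightarrow> polyb f"
  unfolding polyb_def by (meson le_trans)

text \<open>The base \<open>n + 2\<close> is at least 2 even for \<open>n = 0\<close>, so a power of
  it absorbs any constant.\<close>

lemma polyb_const: "polyb (\<lambda>n. c)"
proof -
  have "c \<le> (n + 2) ^ c" for n :: nat
  proof -
    have "c \<le> 2 ^ c"
      by (simp add: less_imp_le)
    also have "\<dots> \<le> (n + 2) ^ c"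
      by (intro power_mono) auto
    finally show ?thesis .
  qed
  then show ?thesis
    unfolding polyb_def by blast
qed

lemma polyb_id: "polyb (\<lambda>n. n)"
  unfolding polyb_def by (rule exI[of _ 1]) simp

lemma polyb_mult:
  assumes "polyb f" "polyb g"
  shows "polyb (\<lambda>n. f n * g n)"
proof -
  obtain k l where "\<And>n. f n \<le> (n + 2) ^ k" "\<And>n. g n \<le> (n + 2) ^ l"
    using assms unfolding polyb_def by blast
  then have "f n * g n \<le> (n + 2) ^ (k + l)" for n
    by (simp only: power_add mult_le_mono)
  then show ?thesis
    unfolding polyb_def by blast
qed

text \<open>Reduced to products by f + g \<le> (f + 1)(g + 1). Only the addition of 1 needs an
  estimate, and one more factor \<open>n + 2\<close> pays for it.\<close>

lemma polyb_add:
  assumes "polyb f" "polyb g"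
  shows "polyb (\<lambda>n. f n + g n)"
proof -
  have "polyb (\<lambda>n. f n + 1)" if f: "polyb f" for f
  proof -
    obtain k where k: "\<And>n. f n \<le> (n + 2) ^ k"
      using f unfolding polyb_def by blast
    have "f n + 1 \<le> (n + 2) ^ (k + 1)" for n
    proof -
      have "1 \<le> (n + 2) ^ k"
        by simp
      with k[of n] have "f n + 1 \<le> 2 * (n + 2) ^ k"
        by linarith
      also have "\<dots> \<le> (n + 2) ^ (k + 1)"
        by simp
      finally show ?thesis .
    qed
    then show ?thesis
      unfolding polyb_def by blast
  qed
  then have "polyb (\<lambda>n. (f n + 1) * (g n + 1))"
    using assms by (intro polyb_mult)
  then show ?thesis
    by (rule polyb_mono) (simp add: algebra_simps)
qed

lemma polyb_Suc: "polyb f \<Longrightarrow> polyb (\<lambda>n. Suc (f n))"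
  using polyb_add[OF _ polyb_const[of 1]] by simp

lemma polyb_power: "polyb f \<Longrightarrow> polyb (\<lambda>n. f n ^ k)"
  by (induction k) (auto intro: polyb_mult polyb_const)

lemmas polyb_intros = polyb_const polyb_id polyb_mult polyb_add polyb_Suc polyb_power

section \<open>Transformations of programs\<close>

lemma vsize_pos: "1 \<le> vsize v"
  by (cases v) auto

text \<open>Function numbers are absolute, so a program placed behind \<open>k\<close> other
  functions in a common list must have all its calls renumbered.\<close>

primrec shift :: "nat \<Rightarrow> exp \<Rightarrow> exp" where
  "shift k (Var i) = Var i"
| "shift k (Const n) = Const n"
| "shift k (CONS a b) = CONS (shift k a) (shift k b)"
| "shift k (Fst a) = Fst (shift k a)"
| "shift k (Snd a) = Snd (shift k a)"
| "shift k (IsPair a) = IsPair (shift k a)"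
| "shift k (Add a b) = Add (shift k a) (shift k b)"
| "shift k (Sub a b) = Sub (shift k a) (shift k b)"
| "shift k (Mul a b) = Mul (shift k a) (shift k b)"
| "shift k (Leq a b) = Leq (shift k a) (shift k b)"
| "shift k (IF a b c) = IF (shift k a) (shift k b) (shift k c)"
| "shift k (LET a b) = LET (shift k a) (shift k b)"
| "shift k (Call f a) = Call (f + k) (shift k a)"

lemma shift_0 [simp]: "shift 0 = id"
proof
  show "shift 0 e = id e" for e
    by (induction e) auto
qed

text \<open>Embedded code calls only embedded functions, and a successful evaluation never looks
  beyond its own environment; hence even the cost is unchanged. The extension
  \<open>\<sigma>\<close> is quantified inside the statement because a \<open>Call\<close> restarts
  in a one-element environment, where the hypothesis is taken at \<open>[]\<close>.\<close>

lemma eval_embed_all: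
  "eval P \<rho> e v t \<Longrightarrow>
    \<forall>\<sigma>. eval (A @ map (shift (length A)) P @ B) (\<rho> @ \<sigma>) (shift (length A) e) v t"
proof (induction rule: eval.induct)
  case (Var i \<rho>)
  show ?case
  proof
    show "eval (A @ map (shift (length A)) P @ B) (\<rho> @ \<sigma>) (shift (length A) (Var i))
      (\<rho> ! i) (1 + vsize (\<rho> ! i))" for \<sigma>
      using eval.Var[of i "\<rho> @ \<sigma>"] Var by (simp add: nth_append)
  qed
next
  case (Call \<rho> e a s f v t)
  let ?Q = "A @ map (shift (length A)) P @ B"
  have nth: "?Q ! (f + length A) = shift (length A) (P ! f)"
    using Call.hyps by (simp add: nth_append)
  have "eval ?Q [a] (shift (length A) (P ! f)) v t"
    using spec[OF Call.IH(2), of "[]"] by simp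
  then show ?case
    using eval.Call[OF spec[OF Call.IH(1)], of "f + length A" v t] nth Call.hyps by simp
qed (simp_all only: shift.simps append_Cons, (fast intro: eval.intros)+)

lemmas eval_embed = eval_embed_all[rule_format]
lemmas eval_extend = eval_embed[where A = "[]", simplified]

definition enc_bool :: "bool \<Rightarrow> val" where
  "enc_bool b = VInt (of_bool b)"

section \<open>Polynomial-time functions\<close>

text \<open>The claim is made for every \<open>x\<close> of the type, not just for meaningful
  inputs, so the closure proofs carry no preconditions. Functions such as \<open>routes\<close> are
  therefore total, with default values.\<close>

definition realizes ::
  "prog \<Rightarrow> exp \<Rightarrow> nat \<Rightarrow> ('a \<Rightarrow> val) \<Rightarrow> ('b \<Rightarrow> val) \<Rightarrow> ('a \<Rightarrow> 'b) \<Rightarrow> bool" where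
  "realizes P e k \<alpha> \<beta> f \<longleftrightarrow>
     (\<forall>x. \<exists>t. eval P [\<alpha> x] e (\<beta> (f x)) t \<and> t \<le> (vsize (\<alpha> x) + 2) ^ k)"

definition ptime :: "('a \<Rightarrow> val) \<Rightarrow> ('b \<Rightarrow> val) \<Rightarrow> ('a \<Rightarrow> 'b) \<Rightarrow> bool" where
  "ptime \<alpha> \<beta> f \<longleftrightarrow> (\<exists>P e k. realizes P e k \<alpha> \<beta> f)"

lemma realizesE:
  assumes "realizes P e k \<alpha> \<beta> f"
  obtains t where "eval P (\<alpha> x # \<rho>) e (\<beta> (f x)) t" "t \<le> (vsize (\<alpha> x) + 2) ^ k"
proof -
  obtain t where t: "eval P [\<alpha> x] e (\<beta> (f x)) t" "t \<le> (vsize (\<alpha> x) + 2) ^ k"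
    using assms unfolding realizes_def by blast
  have "eval P (\<alpha> x # \<rho>) e (\<beta> (f x)) t"
    using eval_extend[OF t(1), of "[]" \<rho>] by simp
  then show ?thesis
    using t(2) by (rule that)
qed

lemma realizes_embed:
  assumes "realizes P e k \<alpha> \<beta> f"
  shows "realizes (A @ map (shift (length A)) P @ B) (shift (length A) e) k \<alpha> \<beta> f"
  unfolding realizes_def
proof
  fix x
  obtain t where "eval P [\<alpha> x] e (\<beta> (f x)) t" "t \<le> (vsize (\<alpha> x) + 2) ^ k"
    using assms unfolding realizes_def by blast
  then show "\<exists>t. eval (A @ map (shift (length A)) P @ B) [\<alpha> x] (shift (length A) e) (\<beta> (f x)) t
      \<and> t \<le> (vsize (\<alpha> x) + 2) ^ k"
    using eval_embed[of P "[\<alpha> x]" e _ t A B "[]"] by auto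
qed

lemma ptimeI:
  assumes "\<And>x. \<exists>t. eval P [\<alpha> x] e (\<beta> (f x)) t \<and> t \<le> b (vsize (\<alpha> x))" "polyb b"
  shows "ptime \<alpha> \<beta> f"
proof -
  obtain k where "\<And>n. b n \<le> (n + 2) ^ k"
    using assms(2) unfolding polyb_def by blast
  then show ?thesis
    using assms(1) unfolding ptime_def realizes_def by (meson le_trans)
qed

text \<open>The first program keeps its function numbers; the second is appended and shifted by the
  length of the first.\<close>

lemma ptime_joint:
  assumes "ptime \<alpha> \<beta> f" "ptime \<alpha>' \<beta>' g"
  obtains P e k e' k' where "realizes P e k \<alpha> \<beta> f" "realizes P e' k' \<alpha>' \<beta>' g"
proof -
  obtain P e k P' e' k' where *: "realizes P e k \<alpha> \<beta> f" "realizes P' e' k' \<alpha>' \<beta>' g"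
    using assms unfolding ptime_def by blast
  show ?thesis
    using realizes_embed[OF *(1), of "[]" "map (shift (length P)) P'"]
      realizes_embed[OF *(2), of P "[]"]
    by (intro that) auto
qed

lemma ptime_joint3:
  assumes "ptime \<alpha> \<beta> f" "ptime \<alpha>' \<beta>' g" "ptime \<alpha>'' \<beta>'' h"
  obtains P e k e' k' e'' k'' where "realizes P e k \<alpha> \<beta> f" "realizes P e' k' \<alpha>' \<beta>' g"
    "realizes P e'' k'' \<alpha>'' \<beta>'' h"
proof -
  obtain P e k e' k' where *: "realizes P e k \<alpha> \<beta> f" "realizes P e' k' \<alpha>' \<beta>' g"
    using ptime_joint[OF assms(1,2)] .
  obtain P'' e'' k'' where **: "realizes P'' e'' k'' \<alpha>'' \<beta>'' h"
    using assms(3) unfolding ptime_def by blast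
  show ?thesis
    using realizes_embed[OF *(1), of "[]" "map (shift (length P)) P''"]
      realizes_embed[OF *(2), of "[]" "map (shift (length P)) P''"]
      realizes_embed[OF **, of P "[]"]
    by (intro that) auto
qed

lemma eval_vsize: "eval P \<rho> e v t \<Longrightarrow> vsize v \<le> t"
  by (induction rule: eval.induct) auto

lemma realizes_vsize:
  assumes "realizes P e k \<alpha> \<beta> f"
  shows "vsize (\<beta> (f x)) \<le> (vsize (\<alpha> x) + 2) ^ k"
  using realizesE[OF assms, of x "[]"] eval_vsize le_trans by metis

lemma ptime_vsize:
  assumes "ptime \<alpha> \<beta> f"
  obtains k where "\<And>x. vsize (\<beta> (f x)) \<le> (vsize (\<alpha> x) + 2) ^ k"
  using assms realizes_vsize unfolding ptime_def by metis

lemma ptime_cong: "ptime \<alpha> \<beta> f \<Longrightarrow> (\<And>x. \<alpha>' x = \<alpha> x) \<Longrightarrow> (\<And>x. \<beta>' (g x) = \<beta> (f x)) \<Longrightarrow>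
  ptime \<alpha>' \<beta>' g"
  unfolding ptime_def realizes_def by simp

lemma ptime_comp:
  assumes "ptime \<beta> \<gamma> g" "ptime \<alpha> \<beta> f"
  shows "ptime \<alpha> \<gamma> (\<lambda>x. g (f x))"
proof -
  obtain P e k e' k' where e: "realizes P e k \<alpha> \<beta> f" and e': "realizes P e' k' \<beta> \<gamma> g"
    using ptime_joint[OF assms(2,1)] .
  let ?b = "\<lambda>n. (n + 2) ^ k + ((n + 2) ^ k + 2) ^ k' + 1 + ((n + 2) ^ k + 2) ^ k'"
  show ?thesis
  proof (rule ptimeI)
    fix x
    let ?n = "vsize (\<alpha> x)"
    obtain s where s: "eval P [\<alpha> x] e (\<beta> (f x)) s" "s \<le> (?n + 2) ^ k"
      using realizesE[OF e] .
    obtain t where t: "eval P [\<beta> (f x), \<alpha> x] e' (\<gamma> (g (f x))) t"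
        "t \<le> (vsize (\<beta> (f x)) + 2) ^ k'"
      using realizesE[OF e'] .
    have "vsize (\<beta> (f x)) \<le> (?n + 2) ^ k"
      using realizes_vsize[OF e] .
    then have "(vsize (\<beta> (f x)) + 2) ^ k' \<le> ((?n + 2) ^ k + 2) ^ k'"
      by (intro power_mono) auto
    then have "t \<le> ((?n + 2) ^ k + 2) ^ k'"
      using t(2) by linarith
    then have "s + t + 1 + vsize (\<gamma> (g (f x))) \<le> ?b ?n"
      using s(2) eval_vsize[OF t(1)] by linarith
    then show "\<exists>t. eval P [\<alpha> x] (LET e e') (\<gamma> (g (f x))) t \<and> t \<le> ?b ?n"
      using eval.LET[OF s(1) t(1)] by blast
  qed (intro polyb_intros)
qed

lemma ptime_pair:
  assumes "ptime \<alpha> \<beta> f" "ptime \<alpha> \<gamma> g"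
  shows "ptime \<alpha> (enc_pair \<beta> \<gamma>) (\<lambda>x. (f x, g x))"
proof -
  obtain P e k e' k' where e: "realizes P e k \<alpha> \<beta> f" and e': "realizes P e' k' \<alpha> \<gamma> g"
    using ptime_joint[OF assms] .
  let ?b = "\<lambda>n. (n + 2) ^ k + (n + 2) ^ k' + 1 + (1 + (n + 2) ^ k + (n + 2) ^ k')"
  show ?thesis
  proof (rule ptimeI)
    fix x
    let ?n = "vsize (\<alpha> x)"
    obtain s where s: "eval P [\<alpha> x] e (\<beta> (f x)) s" "s \<le> (?n + 2) ^ k"
      using realizesE[OF e] .
    obtain t where t: "eval P [\<alpha> x] e' (\<gamma> (g x)) t" "t \<le> (?n + 2) ^ k'"
      using realizesE[OF e'] .
    have "s + t + 1 + vsize (VPair (\<beta> (f x)) (\<gamma> (g x))) \<le> ?b ?n"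
      using s t eval_vsize[OF s(1)] eval_vsize[OF t(1)] by simp
    then show "\<exists>t. eval P [\<alpha> x] (CONS e e') (enc_pair \<beta> \<gamma> (f x, g x)) t \<and> t \<le> ?b ?n"
      using eval.CONS[OF s(1) t(1)] unfolding enc_pair_def fst_conv snd_conv by blast
  qed (intro polyb_intros)
qed

lemma eval_Var0: "eval P (v # \<rho>) (Var 0) v (1 + vsize v)"
  using eval.Var[of 0 "v # \<rho>" P] by simp

lemma ptime_id: "ptime \<alpha> \<alpha> (\<lambda>x. x)"
proof (rule ptimeI)
  show "\<exists>t. eval [] [\<alpha> x] (Var 0) (\<alpha> x) t \<and> t \<le> 1 + vsize (\<alpha> x)" for x
    using eval.Var[of 0 "[\<alpha> x]" "[]"] by auto
qed (intro polyb_intros)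

lemma ptime_fst:
  assumes "ptime \<alpha> (enc_pair \<beta> \<gamma>) f"
  shows "ptime \<alpha> \<beta> (\<lambda>x. fst (f x))"
proof (rule ptime_comp[OF _ assms], rule ptimeI)
  show "\<exists>t. eval [] [enc_pair \<beta> \<gamma> x] (Fst (Var 0)) (\<beta> (fst x)) t \<and>
      t \<le> 2 + 2 * vsize (enc_pair \<beta> \<gamma> x)" for x
    using eval.Fst[OF eval_Var0[of "[]" "VPair (\<beta> (fst x)) (\<gamma> (snd x))" "[]"]]
    unfolding enc_pair_def by (intro exI conjI) (assumption, simp)
qed (intro polyb_intros)

lemma ptime_snd:
  assumes "ptime \<alpha> (enc_pair \<beta> \<gamma>) f"
  shows "ptime \<alpha> \<gamma> (\<lambda>x. snd (f x))"
proof (rule ptime_comp[OF _ assms], rule ptimeI)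
  show "\<exists>t. eval [] [enc_pair \<beta> \<gamma> x] (Snd (Var 0)) (\<gamma> (snd x)) t \<and>
      t \<le> 2 + 2 * vsize (enc_pair \<beta> \<gamma> x)" for x
    using eval.Snd[OF eval_Var0[of "[]" "VPair (\<beta> (fst x)) (\<gamma> (snd x))" "[]"]]
    unfolding enc_pair_def by (intro exI conjI) (assumption, simp)
qed (intro polyb_intros)

lemma ptime_const:
  assumes "\<beta> c = VInt i"
  shows "ptime \<alpha> \<beta> (\<lambda>x. c)"
proof (rule ptimeI)
  show "\<exists>t. eval [] [\<alpha> x] (Const i) (\<beta> c) t \<and> t \<le> 1 + vsize (VInt i)" for x
    using eval.Const[of "[]" "[\<alpha> x]" i] assms by auto
qed (intro polyb_intros)

lemma boundI: "eval P \<rho> e v t \<Longrightarrow> t \<le> b \<Longrightarrow> \<exists>t. eval P \<rho> e v t \<and> t \<le> b"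
  by blast

lemma ptime_if:
  assumes "ptime \<alpha> enc_bool p" "ptime \<alpha> \<beta> f" "ptime \<alpha> \<beta> g"
  shows "ptime \<alpha> \<beta> (\<lambda>x. if p x then f x else g x)"
proof -
  obtain P e k e' k' e'' k'' where
    e: "realizes P e k \<alpha> enc_bool p" and e': "realizes P e' k' \<alpha> \<beta> f" and
    e'': "realizes P e'' k'' \<alpha> \<beta> g"
    using ptime_joint3[OF assms] .
  let ?b = "\<lambda>n. (n + 2) ^ k + 2 * (n + 2) ^ k' + 2 * (n + 2) ^ k'' + 1"
  show ?thesis
  proof (rule ptimeI)
    fix x
    let ?n = "vsize (\<alpha> x)"
    obtain s where s: "eval P [\<alpha> x] e (enc_bool (p x)) s" "s \<le> (?n + 2) ^ k"
      using realizesE[OF e] .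
    show "\<exists>t. eval P [\<alpha> x] (IF e e' e'') (\<beta> (if p x then f x else g x)) t \<and> t \<le> ?b ?n"
    proof (cases "p x")
      case True
      obtain t where t: "eval P [\<alpha> x] e' (\<beta> (f x)) t" "t \<le> (?n + 2) ^ k'"
        using realizesE[OF e'] .
      show ?thesis
        using True s t eval.IF_True[of P "[\<alpha> x]" e 1 s e' "\<beta> (f x)" t e''] eval_vsize[OF t(1)]
        by (intro exI[of _ "s + t + 1 + vsize (\<beta> (f x))"]) (simp add: enc_bool_def)
    next
      case False
      obtain t where t: "eval P [\<alpha> x] e'' (\<beta> (g x)) t" "t \<le> (?n + 2) ^ k''"
        using realizesE[OF e''] .
      show ?thesis
        using False s t eval.IF_False[of P "[\<alpha> x]" e s e'' "\<beta> (g x)" t e'] eval_vsize[OF t(1)]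
        by (intro exI[of _ "s + t + 1 + vsize (\<beta> (g x))"]) (simp add: enc_bool_def)
    qed
  qed (intro polyb_intros)
qed

lemma enc_list_simps [simp]:
  "enc_list \<beta> [] = VInt 0"
  "enc_list \<beta> (y # ys) = VPair (\<beta> y) (enc_list \<beta> ys)"
  by (simp_all add: enc_list_def)

lemma enc_pair_Pair [simp]: "enc_pair \<alpha> \<beta> (x, y) = VPair (\<alpha> x) (\<beta> y)"
  by (simp add: enc_pair_def)

lemma length_le_vsize: "length xs \<le> vsize (enc_list \<beta> xs)"
  by (induction xs) auto

text \<open>A list cell and a pair have the same encoding.\<close>

lemma ptime_Cons:
  assumes "ptime \<alpha> \<beta> f" "ptime \<alpha> (enc_list \<beta>) g"
  shows "ptime \<alpha> (enc_list \<beta>) (\<lambda>x. f x # g x)"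
  by (rule ptime_cong[OF ptime_pair[OF assms]]) auto

lemma ptime_Nil: "ptime \<alpha> (enc_list \<beta>) (\<lambda>x. [])"
  by (rule ptime_const) simp

text \<open>The triple \<open>(x, y, ys)\<close> has literally the same encoding as
  \<open>(x, y # ys)\<close>, so the code for the nonempty case runs on the unchanged input. In the
  empty case a \<open>LET\<close> first extracts \<open>x\<close>.\<close>

lemma ptime_case_list:
  assumes "ptime \<alpha> (enc_list \<beta>) f" "ptime \<alpha> \<gamma> g"
    "ptime (enc_pair \<alpha> (enc_pair \<beta> (enc_list \<beta>))) \<gamma> (\<lambda>z. h (fst z) (fst (snd z)) (snd (snd z)))"
  shows "ptime \<alpha> \<gamma> (\<lambda>x. case f x of [] \<Rightarrow> g x | y # ys \<Rightarrow> h x y ys)"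
proof -
  let ?\<delta> = "enc_pair \<alpha> (enc_list \<beta>)"
  let ?F = "\<lambda>z. case snd z of [] \<Rightarrow> g (fst z) | y # ys \<Rightarrow> h (fst z) y ys"
  obtain P e k e' k' where
    e: "realizes P e k \<alpha> \<gamma> g" and
    e': "realizes P e' k' (enc_pair \<alpha> (enc_pair \<beta> (enc_list \<beta>))) \<gamma>
      (\<lambda>z. h (fst z) (fst (snd z)) (snd (snd z)))"
    using ptime_joint[OF assms(2,3)] .
  let ?c = "IF (IsPair (Snd (Var 0))) e' (LET (Fst (Var 0)) e)"
  let ?b = "\<lambda>n. 5 * n + 10 + 3 * (n + 2) ^ k + 2 * (n + 2) ^ k'"
  have "ptime ?\<delta> \<gamma> ?F"
  proof (rule ptimeI)
    fix z :: "'a \<times> 'b list"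
    obtain x l where z: "z = (x, l)"
      by (cases z)
    let ?v = "?\<delta> z"
    have snd: "eval P [?v] (Snd (Var 0)) (enc_list \<beta> l) (1 + vsize ?v + 1 + vsize (enc_list \<beta> l))"
      unfolding z enc_pair_Pair by (rule eval.Snd[OF eval_Var0])
    have fst: "eval P [?v] (Fst (Var 0)) (\<alpha> x) (1 + vsize ?v + 1 + vsize (\<alpha> x))"
      unfolding z enc_pair_Pair by (rule eval.Fst[OF eval_Var0])
    show "\<exists>t. eval P [?v] ?c (\<gamma> (?F z)) t \<and> t \<le> ?b (vsize ?v)"
    proof (cases l)
      case Nil
      obtain t where t: "eval P [\<alpha> x, ?v] e (\<gamma> (g x)) t" "t \<le> (vsize (\<alpha> x) + 2) ^ k"
        using realizesE[OF e] .
      have "(vsize (\<alpha> x) + 2) ^ k \<le> (vsize ?v + 2) ^ k"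
        by (intro power_mono) (auto simp: z)
      note le = this t(2) eval_vsize[OF t(1)]
      have F: "?F z = g x"
        by (simp add: z Nil)
      show ?thesis
        unfolding F by (rule boundI[OF eval.IF_False[OF
              eval.IsPair_False[OF snd[unfolded Nil enc_list_simps]] eval.LET[OF fst t(1)]]])
          (use le in \<open>simp add: z Nil\<close>)
    next
      case (Cons y ys)
      obtain t where t: "eval P [?v] e' (\<gamma> (h x y ys)) t" "t \<le> (vsize ?v + 2) ^ k'"
        using realizesE[OF e', of "(x, y, ys)"] by (auto simp: z Cons)
      note le = this eval_vsize[OF t(1)]
      have F: "?F z = h x y ys"
        by (simp add: z Cons)
      show ?thesis
        unfolding F by (rule boundI[OF eval.IF_True[OF
              eval.IsPair_True[OF snd[unfolded Cons enc_list_simps]] _ t(1)]])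
          (use le in \<open>simp_all add: z Cons floorlog_def\<close>)
    qed
  qed (intro polyb_intros)
  from ptime_comp[OF this ptime_pair[OF ptime_id assms(1)]] show ?thesis
    by (simp only: fst_conv snd_conv)
qed

section \<open>Sizes of integers and arithmetic\<close>

lemma vsize_VInt_le: "\<bar>i\<bar> < 2 ^ k \<Longrightarrow> vsize (VInt i) \<le> 1 + k"
  by (auto intro!: floorlog_leI simp: nat_less_iff)

lemma abs_less_vsize: "\<bar>i\<bar> < 2 ^ (vsize (VInt i) - 1)"
  using floorlog_leD[of 2 "nat \<bar>i\<bar>", OF order_refl] by (simp add: nat_less_iff)

text \<open>Coarser than the maximum plus one, but of the same form as the bound for products;
  \<open>ptime_binop\<close> and the \<open>growth\<close> rules can then treat both operations
  alike.\<close>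

lemma vsize_add: "vsize (VInt (i + j)) \<le> vsize (VInt i) + vsize (VInt j)"
proof -
  let ?m = "vsize (VInt i) - 1" and ?n = "vsize (VInt j) - 1"
  have "\<bar>i + j\<bar> < 2 ^ ?m + 2 ^ ?n"
    using abs_less_vsize[of i] abs_less_vsize[of j] by linarith
  also have "\<dots> \<le> 2 ^ (?m + ?n) * 2"
    using power_increasing[of ?m "?m + ?n" "2 :: int"] power_increasing[of ?n "?m + ?n" "2 :: int"]
    by linarith
  finally have "\<bar>i + j\<bar> < 2 ^ (?m + ?n + 1)"
    by simp
  from vsize_VInt_le[OF this] show ?thesis
    by simp
qed

lemma vsize_mult: "vsize (VInt (i * j)) \<le> vsize (VInt i) + vsize (VInt j)"
proof -
  let ?m = "vsize (VInt i) - 1" and ?n = "vsize (VInt j) - 1"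
  have "\<bar>i * j\<bar> < 2 ^ ?m * 2 ^ ?n"
    unfolding abs_mult using abs_less_vsize by (intro mult_strict_mono) auto
  then have "\<bar>i * j\<bar> < 2 ^ (?m + ?n)"
    by (simp add: power_add)
  from vsize_VInt_le[OF this] show ?thesis
    by simp
qed

lemma vsize_of_bool: "vsize (VInt (of_bool b)) \<le> 2"
  using vsize_VInt_le[of "of_bool b" 1] by simp

lemma ptime_binop:
  assumes op: "\<And>P \<rho> e e' m n s t. eval P \<rho> e (VInt m) s \<Longrightarrow> eval P \<rho> e' (VInt n) t \<Longrightarrow>
      eval P \<rho> (opr e e') (\<beta> (f m n)) (s + t + 1 + vsize (\<beta> (f m n)))"
    and size: "\<And>m n. vsize (\<beta> (f m n)) \<le> vsize (VInt m) + vsize (VInt n)"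
    and g: "ptime \<alpha> VInt g" and h: "ptime \<alpha> VInt h"
  shows "ptime \<alpha> \<beta> (\<lambda>x. f (g x) (h x))"
proof -
  have "ptime (enc_pair VInt VInt) \<beta> (\<lambda>z. f (fst z) (snd z))"
  proof (rule ptimeI)
    fix z :: "int \<times> int"
    obtain m n where z: "z = (m, n)"
      by (cases z)
    show "\<exists>t. eval [] [enc_pair VInt VInt z] (opr (Fst (Var 0)) (Snd (Var 0)))
        (\<beta> (f (fst z) (snd z))) t \<and> t \<le> 10 * vsize (enc_pair VInt VInt z)"
      unfolding z enc_pair_Pair fst_conv snd_conv
      by (rule boundI[OF op[OF eval.Fst[OF eval_Var0] eval.Snd[OF eval_Var0]]])
        (use size[of m n] in simp)
  qed (intro polyb_intros)
  from ptime_comp[OF this ptime_pair[OF g h]] show ?thesis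
    by simp
qed

lemma ptime_add:
  assumes "ptime \<alpha> VInt f" "ptime \<alpha> VInt g"
  shows "ptime \<alpha> VInt (\<lambda>x. f x + g x)"
  by (rule ptime_binop[where opr = Add, OF _ _ assms]) (rule eval.Add vsize_add; assumption)+

lemma ptime_mult:
  assumes "ptime \<alpha> VInt f" "ptime \<alpha> VInt g"
  shows "ptime \<alpha> VInt (\<lambda>x. f x * g x)"
  by (rule ptime_binop[where opr = Mul, OF _ _ assms]) (rule eval.Mul vsize_mult; assumption)+

lemma ptime_le:
  assumes "ptime \<alpha> VInt f" "ptime \<alpha> VInt g"
  shows "ptime \<alpha> enc_bool (\<lambda>x. f x \<le> g x)"
proof (rule ptime_binop[where opr = Leq, OF _ _ assms])
  show "vsize (enc_bool (m \<le> n)) \<le> vsize (VInt m) + vsize (VInt n)" for m n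
    using vsize_of_bool[of "m \<le> n"] vsize_pos[of "VInt m"] vsize_pos[of "VInt n"]
    unfolding enc_bool_def by linarith
qed (auto simp only: enc_bool_def intro: eval.Leq)

lemma ptime_True: "ptime \<alpha> enc_bool (\<lambda>x. True)"
  and ptime_False: "ptime \<alpha> enc_bool (\<lambda>x. False)"
  by (auto intro: ptime_const simp: enc_bool_def)

lemma ptime_not:
  assumes "ptime \<alpha> enc_bool p"
  shows "ptime \<alpha> enc_bool (\<lambda>x. \<not> p x)"
  using ptime_if[OF assms ptime_False ptime_True] by (rule ptime_cong) auto

lemma ptime_conj:
  assumes "ptime \<alpha> enc_bool p" "ptime \<alpha> enc_bool q"
  shows "ptime \<alpha> enc_bool (\<lambda>x. p x \<and> q x)"
  using ptime_if[OF assms ptime_False] by (rule ptime_cong) auto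

lemma ptime_disj:
  assumes "ptime \<alpha> enc_bool p" "ptime \<alpha> enc_bool q"
  shows "ptime \<alpha> enc_bool (\<lambda>x. p x \<or> q x)"
  using ptime_if[OF assms(1) ptime_True assms(2)] by (rule ptime_cong) auto

lemma ptime_eq_nat:
  assumes "ptime \<alpha> enc_nat f" "ptime \<alpha> enc_nat g"
  shows "ptime \<alpha> enc_bool (\<lambda>x. f x = g x)"
proof -
  have int: "ptime \<alpha> VInt (\<lambda>x. int (h x))" if "ptime \<alpha> enc_nat h" for h
    by (rule ptime_cong[OF that]) (auto simp: enc_nat_def)
  show ?thesis
    by (rule ptime_cong[OF ptime_conj[OF ptime_le[OF int int] ptime_le[OF int int]],
          OF assms assms(2,1)]) (auto simp: order_eq_iff)
qed

section \<open>Recursion on lists\<close>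

text \<open>A paramorphism: unlike in a fold, the step also sees the tail. \<open>cost\<close> and
  \<open>walk\<close> need the tail to look at the next path, \<open>dropWhile\<close> and sorted
  insertion to return the rest of the list untouched.\<close>

primrec para :: "('b \<Rightarrow> 'b list \<Rightarrow> 'c \<Rightarrow> 'c) \<Rightarrow> 'c \<Rightarrow> 'b list \<Rightarrow> 'c" where
  "para g i [] = i"
| "para g i (y # ys) = g y ys (para g i ys)"

text \<open>
  The body of function number 0. Variable 0 holds the pair of the environment and the list; \<open>e\<^sub>g\<close>
  finds the four arguments of the step function, and \<open>e\<^sub>i\<close> the environment, in variable 0.
\<close>

definition para_body :: "exp \<Rightarrow> exp \<Rightarrow> exp" where
  "para_body e\<^sub>g e\<^sub>i = IF (IsPair (Snd (Var 0)))
     (LET (Call 0 (CONS (Fst (Var 0)) (Snd (Snd (Var 0)))))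
       (LET (CONS (Fst (Var 1)) (CONS (Fst (Snd (Var 1))) (CONS (Snd (Snd (Var 1))) (Var 0)))) e\<^sub>g))
     (LET (Fst (Var 0)) e\<^sub>i)"

lemma eval_Var1: "eval P (u # v # \<rho>) (Var 1) v (1 + vsize v)"
  using eval.Var[of 1 "u # v # \<rho>" P] by simp

text \<open>A polynomial-time step is not enough: one that doubles its accumulator reaches
  exponential size. Hence the explicit bound on all intermediate values; with it, every level of the
  recursion has the same polynomial cost.\<close>

lemma ptime_para_aux:
  fixes g :: "'a \<Rightarrow> 'b \<Rightarrow> 'b list \<Rightarrow> 'c \<Rightarrow> 'c"
  assumes g: "ptime (enc_pair \<alpha> (enc_pair \<beta> (enc_pair (enc_list \<beta>) \<gamma>))) \<gamma>
      (\<lambda>z. g (fst z) (fst (snd z)) (fst (snd (snd z))) (snd (snd (snd z))))"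
    and i: "ptime \<alpha> \<gamma> i"
    and bound: "\<And>x ys. vsize (\<gamma> (para (g x) (i x) ys)) \<le> (vsize (\<alpha> x) + vsize (enc_list \<beta> ys) + 2) ^ k"
  shows "ptime (enc_pair \<alpha> (enc_list \<beta>)) \<gamma> (\<lambda>z. para (g (fst z)) (i (fst z)) (snd z))"
proof -
  obtain P\<^sub>0 d\<^sub>g k\<^sub>g d\<^sub>i k\<^sub>i where
    "realizes P\<^sub>0 d\<^sub>g k\<^sub>g (enc_pair \<alpha> (enc_pair \<beta> (enc_pair (enc_list \<beta>) \<gamma>))) \<gamma>
      (\<lambda>z. g (fst z) (fst (snd z)) (fst (snd (snd z))) (snd (snd (snd z))))"
    "realizes P\<^sub>0 d\<^sub>i k\<^sub>i \<alpha> \<gamma> i"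
    using ptime_joint[OF g i] .
  moreover define e\<^sub>g e\<^sub>i where "e\<^sub>g = shift 1 d\<^sub>g" and "e\<^sub>i = shift 1 d\<^sub>i"
  moreover define P where "P = para_body e\<^sub>g e\<^sub>i # map (shift 1) P\<^sub>0"
  ultimately have
    e\<^sub>g: "realizes P e\<^sub>g k\<^sub>g (enc_pair \<alpha> (enc_pair \<beta> (enc_pair (enc_list \<beta>) \<gamma>))) \<gamma>
      (\<lambda>z. g (fst z) (fst (snd z)) (fst (snd (snd z))) (snd (snd (snd z))))" and
    e\<^sub>i: "realizes P e\<^sub>i k\<^sub>i \<alpha> \<gamma> i"
    using realizes_embed[where A = "[para_body e\<^sub>g e\<^sub>i]" and B = "[]" and P = P\<^sub>0] by simp_all
  \<comment> \<open>The cost of one level, with \<open>n\<close> the size of the whole input, kept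
    fixed while the list shrinks. The summands pay for copying parts of the input, for copying
    results, for the step function on its four-part argument, and for the base case.\<close>
  define D where "D n = 40 * (n + 1) + 20 * (n + 2) ^ k + 4 * (2 * n + (n + 2) ^ k + 5) ^ k\<^sub>g
    + 4 * (n + 2) ^ k\<^sub>i" for n :: nat
  have step: "\<exists>t. eval P [VPair (\<alpha> x) (enc_list \<beta> ys)] (para_body e\<^sub>g e\<^sub>i)
      (\<gamma> (para (g x) (i x) ys)) t \<and> t \<le> (length ys + 1) * D n"
    if "1 + vsize (\<alpha> x) + vsize (enc_list \<beta> ys) \<le> n" for x ys n
    using that
  proof (induction ys)
    case Nil
    obtain t where t: "eval P [\<alpha> x, VPair (\<alpha> x) (VInt 0)] e\<^sub>i (\<gamma> (i x)) t" "t \<le> (vsize (\<alpha> x) + 2) ^ k\<^sub>i"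
      using realizesE[OF e\<^sub>i] .
    have "(vsize (\<alpha> x) + 2) ^ k\<^sub>i \<le> (n + 2) ^ k\<^sub>i"
      using Nil by (intro power_mono) auto
    then have "t \<le> (n + 2) ^ k\<^sub>i"
      using t(2) by linarith
    note le = this eval_vsize[OF t(1)] Nil
    show ?case
      unfolding para_body_def enc_list_simps para.simps
      by (rule boundI[OF eval.IF_False[OF eval.IsPair_False[OF eval.Snd[OF eval_Var0]]
            eval.LET[OF eval.Fst[OF eval_Var0] t(1)]]])
        (use le in \<open>simp add: D_def\<close>)
  next
    case (Cons y ys)
    let ?x = "\<alpha> x" and ?y = "\<beta> y" and ?ys = "enc_list \<beta> ys"
    let ?z = "VPair ?x (VPair ?y ?ys)"
    define a where "a = para (g x) (i x) ys"
    define v where "v = \<gamma> (g x y ys a)"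
    let ?w = "VPair ?x (VPair ?y (VPair ?ys (\<gamma> a)))"
    obtain s where s: "eval P [VPair ?x ?ys] (para_body e\<^sub>g e\<^sub>i) (\<gamma> a) s" "s \<le> (length ys + 1) * D n"
      using Cons unfolding a_def by auto
    have call: "eval P [VPair ?x ?ys] (P ! 0) (\<gamma> a) s"
      using s(1) by (simp add: P_def)
    have P: "0 < length P"
      by (simp add: P_def)
    obtain t where t: "eval P [?w, \<gamma> a, ?z] e\<^sub>g v t" "t \<le> (vsize ?w + 2) ^ k\<^sub>g"
      using realizesE[OF e\<^sub>g, of "(x, y, ys, a)" "[\<gamma> a, ?z]"] unfolding v_def by auto
    have n: "(vsize ?x + vsize (enc_list \<beta> xs) + 2) ^ k \<le> (n + 2) ^ k"
      if "vsize (enc_list \<beta> xs) \<le> vsize (enc_list \<beta> (y # ys))" for xs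
      using Cons that by (intro power_mono) auto
    have a: "vsize (\<gamma> a) \<le> (n + 2) ^ k"
      using bound[of x ys] n[of ys] unfolding a_def by simp
    have v: "vsize v \<le> (n + 2) ^ k"
      using bound[of x "y # ys"] n[of "y # ys"] unfolding v_def a_def by simp
    have "vsize ?w + 2 \<le> 2 * n + (n + 2) ^ k + 5"
      using a Cons.prems by simp
    then have "(vsize ?w + 2) ^ k\<^sub>g \<le> (2 * n + (n + 2) ^ k + 5) ^ k\<^sub>g"
      by (intro power_mono) auto
    then have "t \<le> (2 * n + (n + 2) ^ k + 5) ^ k\<^sub>g"
      using t(2) by linarith
    note le = a v this s(2) Cons.prems
    have "\<exists>t. eval P [?z] (para_body e\<^sub>g e\<^sub>i) v t \<and> t \<le> s + D n"
      unfolding para_body_def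
      by (rule boundI[OF eval.IF_True[OF eval.IsPair_True[OF eval.Snd[OF eval_Var0]] _
            eval.LET[OF eval.Call[OF eval.CONS[OF eval.Fst[OF eval_Var0]
              eval.Snd[OF eval.Snd[OF eval_Var0]]] P call]
            eval.LET[OF eval.CONS[OF eval.Fst[OF eval_Var1] eval.CONS[OF eval.Fst[OF eval.Snd[OF eval_Var1]]
              eval.CONS[OF eval.Snd[OF eval.Snd[OF eval_Var1]] eval_Var0]]] t(1)]]]])
        (use le in \<open>simp_all add: D_def floorlog_def\<close>)
    then show ?case
      using s(2) unfolding v_def a_def by fastforce
  qed
  let ?b = "\<lambda>n. (n + 1) * D n + 10 * n + (n + 2) ^ k + 10"
  show ?thesis
  proof (rule ptimeI)
    fix z :: "'a \<times> 'b list"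
    obtain x ys where z: "z = (x, ys)"
      by (cases z)
    let ?v = "VPair (\<alpha> x) (enc_list \<beta> ys)"
    obtain t where t: "eval P [?v] (P ! 0) (\<gamma> (para (g x) (i x) ys)) t" "t \<le> (length ys + 1) * D (vsize ?v)"
      using step[of x ys "vsize ?v"] by (auto simp: P_def)
    have "(length ys + 1) * D (vsize ?v) \<le> (vsize ?v + 1) * D (vsize ?v)"
      using length_le_vsize[of ys \<beta>] by (intro mult_right_mono) auto
    moreover have "(vsize (\<alpha> x) + vsize (enc_list \<beta> ys) + 2) ^ k \<le> (vsize ?v + 2) ^ k"
      by (intro power_mono) auto
    ultimately have le: "t \<le> (vsize ?v + 1) * D (vsize ?v)"
      "vsize (\<gamma> (para (g x) (i x) ys)) \<le> (vsize ?v + 2) ^ k"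
      using t(2) bound[of x ys] by linarith+
    show "\<exists>t. eval P [enc_pair \<alpha> (enc_list \<beta>) z] (Call 0 (Var 0))
        (\<gamma> (para (g (fst z)) (i (fst z)) (snd z))) t \<and> t \<le> ?b (vsize (enc_pair \<alpha> (enc_list \<beta>) z))"
      unfolding z enc_pair_Pair fst_conv snd_conv
    proof (rule boundI[OF eval.Call[OF eval_Var0 _ t(1)]])
      show "0 < length P"
        by (simp add: P_def)
      show "1 + vsize ?v + t + 1 + vsize (\<gamma> (para (g x) (i x) ys)) \<le> ?b (vsize ?v)"
        using le by linarith
    qed
  qed (unfold D_def, intro polyb_intros)
qed

lemma ptime_para_bounded:
  assumes l: "ptime \<alpha> (enc_list \<beta>) l" and i: "ptime \<alpha> \<gamma> i"
    and g: "ptime (enc_pair \<alpha> (enc_pair \<beta> (enc_pair (enc_list \<beta>) \<gamma>))) \<gamma>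
      (\<lambda>z. g (fst z) (fst (snd z)) (fst (snd (snd z))) (snd (snd (snd z))))"
    and bound: "\<And>x ys. vsize (\<gamma> (para (g x) (i x) ys)) \<le> b (vsize (\<alpha> x) + vsize (enc_list \<beta> ys))"
    and b: "polyb b"
  shows "ptime \<alpha> \<gamma> (\<lambda>x. para (g x) (i x) (l x))"
proof -
  obtain k where "\<And>n. b n \<le> (n + 2) ^ k"
    using b unfolding polyb_def by blast
  then have "vsize (\<gamma> (para (g x) (i x) ys)) \<le> (vsize (\<alpha> x) + vsize (enc_list \<beta> ys) + 2) ^ k" for x ys
    using bound le_trans by blast
  from ptime_comp[OF ptime_para_aux[OF g i this] ptime_pair[OF ptime_id l]] show ?thesis
    by simp
qed

text \<open>
  A step function under which the accumulator grows only by an amount depending on the list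
  traversed, as opposed to the accumulator, can be iterated in polynomial time.
\<close>

definition growth :: "('a \<Rightarrow> val) \<Rightarrow> ('c \<Rightarrow> val) \<Rightarrow> ('a \<Rightarrow> 'c \<Rightarrow> 'c) \<Rightarrow> bool" where
  "growth \<alpha> \<gamma> h \<longleftrightarrow> (\<exists>b. polyb b \<and> mono b \<and> (\<forall>x a. vsize (\<gamma> (h x a)) \<le> vsize (\<gamma> a) + b (vsize (\<alpha> x))))"

lemma growthI:
  assumes "polyb b" "\<And>x a. vsize (\<gamma> (h x a)) \<le> vsize (\<gamma> a) + b (vsize (\<alpha> x))"
  shows "growth \<alpha> \<gamma> h"
proof -
  obtain k where "\<And>n. b n \<le> (n + 2) ^ k"
    using assms(1) unfolding polyb_def by blast
  moreover have "mono (\<lambda>n :: nat. (n + 2) ^ k)"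
    by (intro monoI power_mono) auto
  moreover have "polyb (\<lambda>n. (n + 2) ^ k)"
    by (intro polyb_intros)
  ultimately show ?thesis
    using assms(2) unfolding growth_def by (meson le_trans add_left_mono)
qed

lemma ptime_para:
  assumes l: "ptime \<alpha> (enc_list \<beta>) l" and i: "ptime \<alpha> \<gamma> i"
    and g: "ptime (enc_pair \<alpha> (enc_pair \<beta> (enc_pair (enc_list \<beta>) \<gamma>))) \<gamma>
      (\<lambda>z. g (fst z) (fst (snd z)) (fst (snd (snd z))) (snd (snd (snd z))))"
    and growth: "growth (enc_pair \<alpha> (enc_pair \<beta> (enc_list \<beta>))) \<gamma>
      (\<lambda>z a. g (fst z) (fst (snd z)) (snd (snd z)) a)"
  shows "ptime \<alpha> \<gamma> (\<lambda>x. para (g x) (i x) (l x))"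
proof -
  obtain b where b: "polyb b" "mono b" and step:
    "\<And>x y ys a. vsize (\<gamma> (g x y ys a)) \<le> vsize (\<gamma> a) + b (2 + vsize (\<alpha> x) + vsize (\<beta> y) + vsize (enc_list \<beta> ys))"
    using growth unfolding growth_def by (fastforce simp: enc_pair_def ac_simps)
  obtain k where k: "\<And>x. vsize (\<gamma> (i x)) \<le> (vsize (\<alpha> x) + 2) ^ k"
    using ptime_vsize[OF i] by blast
  obtain m where m: "\<And>n. b n \<le> (n + 2) ^ m"
    using b(1) unfolding polyb_def by blast
  have "vsize (\<gamma> (para (g x) (i x) ys)) \<le> (n + 2) ^ k + length ys * b (1 + n)"
    if "vsize (\<alpha> x) + vsize (enc_list \<beta> ys) \<le> n" for x ys n
    using that
  proof (induction ys)
    case Nil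
    have "(vsize (\<alpha> x) + 2) ^ k \<le> (n + 2) ^ k"
      using Nil by (intro power_mono) auto
    then show ?case
      using k[of x] by simp
  next
    case (Cons y ys)
    \<comment> \<open>The argument of the step has two pair cells where \<open>n\<close> already
      counts one list cell, hence \<open>1 + n\<close>.\<close>
    have "b (2 + vsize (\<alpha> x) + vsize (\<beta> y) + vsize (enc_list \<beta> ys)) \<le> b (1 + n)"
      using Cons.prems by (intro monoD[OF b(2)]) simp
    then show ?case
      using Cons step[of x y ys "para (g x) (i x) ys"] by simp
  qed
  then have *: "vsize (\<gamma> (para (g x) (i x) ys)) \<le> (n + 2) ^ k + length ys * b (1 + n)"
    if "n = vsize (\<alpha> x) + vsize (enc_list \<beta> ys)" for x ys n
    using that by simp
  show ?thesis
  proof (rule ptime_para_bounded[OF l i g])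
    show "polyb (\<lambda>n. (n + 2) ^ k + n * (1 + n + 2) ^ m)"
      by (intro polyb_intros)
    show "vsize (\<gamma> (para (g x) (i x) ys)) \<le> (vsize (\<alpha> x) + vsize (enc_list \<beta> ys) + 2) ^ k +
      (vsize (\<alpha> x) + vsize (enc_list \<beta> ys)) * (1 + (vsize (\<alpha> x) + vsize (enc_list \<beta> ys)) + 2) ^ m" for x ys
      by (rule order_trans[OF *[OF refl]])
        (intro add_left_mono mult_mono m, use length_le_vsize[of ys \<beta>] in auto)
  qed
qed

lemma growth_const:
  assumes "ptime \<alpha> \<gamma> f"
  shows "growth \<alpha> \<gamma> (\<lambda>x a. f x)"
proof -
  obtain k where "\<And>x. vsize (\<gamma> (f x)) \<le> (vsize (\<alpha> x) + 2) ^ k"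
    using ptime_vsize[OF assms] by blast
  then show ?thesis
    by (intro growthI[where b = "\<lambda>n. (n + 2) ^ k"] polyb_intros trans_le_add2)
qed

lemma growth_id: "growth \<alpha> \<gamma> (\<lambda>x a. a)"
  by (rule growthI[where b = "\<lambda>n. 0"]) (auto intro: polyb_intros)

lemma growth_bool: "growth \<alpha> enc_bool h"
  by (rule growthI[where b = "\<lambda>n. 2"])
    (simp_all only: polyb_const enc_bool_def trans_le_add2 vsize_of_bool)

lemma growth_if:
  assumes "growth \<alpha> \<gamma> f" "growth \<alpha> \<gamma> g"
  shows "growth \<alpha> \<gamma> (\<lambda>x a. if p x a then f x a else g x a)"
proof -
  obtain b b' where b: "polyb b" "polyb b'" and le:
    "\<And>x a. vsize (\<gamma> (f x a)) \<le> vsize (\<gamma> a) + b (vsize (\<alpha> x))"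
    "\<And>x a. vsize (\<gamma> (g x a)) \<le> vsize (\<gamma> a) + b' (vsize (\<alpha> x))"
    using assms unfolding growth_def by blast
  show ?thesis
  proof (rule growthI[where b = "\<lambda>n. b n + b' n"])
    show "vsize (\<gamma> (if p x a then f x a else g x a)) \<le> vsize (\<gamma> a) + (b (vsize (\<alpha> x)) + b' (vsize (\<alpha> x)))" for x a
      using le(1)[of x a] le(2)[of x a] by simp
  qed (intro polyb_intros b)
qed

lemma growth_additive:
  assumes f: "ptime \<alpha> \<beta> f" and h: "growth \<alpha> \<gamma> h"
    and op: "\<And>y a. vsize (\<gamma> (g y a)) \<le> 1 + vsize (\<beta> y) + vsize (\<gamma> a)"
  shows "growth \<alpha> \<gamma> (\<lambda>x a. g (f x) (h x a))"
proof -
  obtain b where b: "polyb b" "\<And>x a. vsize (\<gamma> (h x a)) \<le> vsize (\<gamma> a) + b (vsize (\<alpha> x))"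
    using h unfolding growth_def by blast
  obtain k where k: "\<And>x. vsize (\<beta> (f x)) \<le> (vsize (\<alpha> x) + 2) ^ k"
    using ptime_vsize[OF f] by blast
  show ?thesis
  proof (rule growthI[where b = "\<lambda>n. 1 + (n + 2) ^ k + b n"])
    show "vsize (\<gamma> (g (f x) (h x a))) \<le> vsize (\<gamma> a) + (1 + (vsize (\<alpha> x) + 2) ^ k + b (vsize (\<alpha> x)))" for x a
      using b(2)[of x a] k[of x] op[of "f x" "h x a"] by linarith
  qed (intro polyb_intros b(1))
qed

lemma vsize_append: "vsize (enc_list \<beta> (xs @ ys)) \<le> vsize (enc_list \<beta> xs) + vsize (enc_list \<beta> ys)"
  by (induction xs) auto

lemma growth_Cons:
  "ptime \<alpha> \<beta> f \<Longrightarrow> growth \<alpha> (enc_list \<beta>) h \<Longrightarrow> growth \<alpha> (enc_list \<beta>) (\<lambda>x a. f x # h x a)"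
  by (rule growth_additive) auto

lemma growth_append:
  "ptime \<alpha> (enc_list \<beta>) f \<Longrightarrow> growth \<alpha> (enc_list \<beta>) h \<Longrightarrow> growth \<alpha> (enc_list \<beta>) (\<lambda>x a. f x @ h x a)"
  by (rule growth_additive) (auto intro: order_trans[OF vsize_append])

lemma growth_append2:
  "ptime \<alpha> (enc_list \<beta>) f \<Longrightarrow> growth \<alpha> (enc_list \<beta>) h \<Longrightarrow> growth \<alpha> (enc_list \<beta>) (\<lambda>x a. h x a @ f x)"
  by (rule growth_additive[where g = "\<lambda>y a. a @ y"]) (auto intro: order_trans[OF vsize_append])

lemma growth_add:
  "ptime \<alpha> VInt f \<Longrightarrow> growth \<alpha> VInt h \<Longrightarrow> growth \<alpha> VInt (\<lambda>x a. f x + h x a)"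
  by (rule growth_additive) (use vsize_add in \<open>auto simp only: add.assoc intro: trans_le_add2\<close>)

lemma growth_mult:
  "ptime \<alpha> VInt f \<Longrightarrow> growth \<alpha> VInt h \<Longrightarrow> growth \<alpha> VInt (\<lambda>x a. f x * h x a)"
  by (rule growth_additive) (use vsize_mult in \<open>auto simp only: add.assoc intro: trans_le_add2\<close>)

lemma ptime_comp2:
  assumes "ptime (enc_pair \<beta> \<gamma>) \<delta> (\<lambda>z. h (fst z) (snd z))" "ptime \<alpha> \<beta> f" "ptime \<alpha> \<gamma> g"
  shows "ptime \<alpha> \<delta> (\<lambda>x. h (f x) (g x))"
  using ptime_comp[OF assms(1) ptime_pair[OF assms(2,3)]] by simp

lemma ptime_int: "ptime \<alpha> VInt (\<lambda>x. c)"
  by (rule ptime_const) (rule refl)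

lemmas ptime_basic = ptime_id ptime_fst ptime_snd ptime_pair ptime_if ptime_Cons ptime_Nil
  ptime_add ptime_mult ptime_le ptime_True ptime_False ptime_not ptime_conj ptime_disj ptime_eq_nat
  growth_bool growth_Cons growth_append growth_append2 growth_add growth_mult growth_if growth_id
  ptime_int

section \<open>Standard list functions\<close>

lemma ptime_append:
  assumes "ptime \<alpha> (enc_list \<beta>) f" "ptime \<alpha> (enc_list \<beta>) g"
  shows "ptime \<alpha> (enc_list \<beta>) (\<lambda>x. f x @ g x)"
proof -
  have "ptime \<alpha> (enc_list \<beta>) (\<lambda>x. para (\<lambda>y ys a. y # a) (g x) (f x))"
    by (rule ptime_para[OF assms]; (rule ptime_basic)+)
  moreover have "para (\<lambda>y ys a. y # a) i l = l @ i" for i and l :: "'b list"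
    by (induction l) auto
  ultimately show ?thesis
    by (simp only:)
qed

lemma ptime_map:
  assumes l: "ptime \<alpha> (enc_list \<beta>) l" and f: "ptime (enc_pair \<alpha> \<beta>) \<gamma> (\<lambda>z. f (fst z) (snd z))"
  shows "ptime \<alpha> (enc_list \<gamma>) (\<lambda>x. map (f x) (l x))"
proof -
  have "ptime \<alpha> (enc_list \<gamma>) (\<lambda>x. para (\<lambda>y ys a. f x y # a) [] (l x))"
    by (rule ptime_para[OF l ptime_Nil]; (rule ptime_comp2[where h = f, OF f] ptime_basic)+)
  moreover have "para (\<lambda>y ys a. f x y # a) [] l = map (f x) l" for x l
    by (induction l) auto
  ultimately show ?thesis
    by (simp only:)
qed

lemma ptime_filter:
  assumes l: "ptime \<alpha> (enc_list \<beta>) l" and p: "ptime (enc_pair \<alpha> \<beta>) enc_bool (\<lambda>z. p (fst z) (snd z))"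
  shows "ptime \<alpha> (enc_list \<beta>) (\<lambda>x. filter (p x) (l x))"
proof -
  have "ptime \<alpha> (enc_list \<beta>) (\<lambda>x. para (\<lambda>y ys a. if p x y then y # a else a) [] (l x))"
    by (rule ptime_para[OF l ptime_Nil]; (rule ptime_basic ptime_comp2[where h = p, OF p])+)
  moreover have "para (\<lambda>y ys a. if p x y then y # a else a) [] l = filter (p x) l" for x l
    by (induction l) auto
  ultimately show ?thesis
    by (simp only:)
qed

lemma ptime_all:
  assumes l: "ptime \<alpha> (enc_list \<beta>) l" and p: "ptime (enc_pair \<alpha> \<beta>) enc_bool (\<lambda>z. p (fst z) (snd z))"
  shows "ptime \<alpha> enc_bool (\<lambda>x. \<forall>y \<in> set (l x). p x y)"
proof -
  have "ptime \<alpha> enc_bool (\<lambda>x. para (\<lambda>y ys a. p x y \<and> a) True (l x))"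
    by (rule ptime_para[OF l ptime_True]; (rule ptime_basic ptime_comp2[where h = p, OF p])+)
  moreover have "para (\<lambda>y ys a. p x y \<and> a) True l \<longleftrightarrow> (\<forall>y \<in> set l. p x y)" for x l
    by (induction l) auto
  ultimately show ?thesis
    by (simp only:)
qed

lemma ptime_sum_list:
  assumes l: "ptime \<alpha> (enc_list \<beta>) l" and f: "ptime (enc_pair \<alpha> \<beta>) VInt (\<lambda>z. f (fst z) (snd z))"
  shows "ptime \<alpha> VInt (\<lambda>x. \<Sum>y\<leftarrow>l x. f x y)"
proof -
  have "ptime \<alpha> VInt (\<lambda>x. para (\<lambda>y ys a. f x y + a) 0 (l x))"
    by (rule ptime_para[OF l ptime_int]; (rule ptime_comp2[where h = f, OF f] ptime_basic)+)
  moreover have "para (\<lambda>y ys a. f x y + a) 0 l = (\<Sum>y\<leftarrow>l. f x y)" for x l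
    by (induction l) auto
  ultimately show ?thesis
    by (simp only:)
qed

lemma ptime_prod_list:
  assumes l: "ptime \<alpha> (enc_list \<beta>) l" and f: "ptime (enc_pair \<alpha> \<beta>) VInt (\<lambda>z. f (fst z) (snd z))"
  shows "ptime \<alpha> VInt (\<lambda>x. \<Prod>y\<leftarrow>l x. f x y)"
proof -
  have "ptime \<alpha> VInt (\<lambda>x. para (\<lambda>y ys a. f x y * a) 1 (l x))"
    by (rule ptime_para[OF l ptime_int]; (rule ptime_comp2[where h = f, OF f] ptime_basic)+)
  moreover have "para (\<lambda>y ys a. f x y * a) 1 l = (\<Prod>y\<leftarrow>l. f x y)" for x l
    by (induction l) auto
  ultimately show ?thesis
    by (simp only:)
qed

lemma ptime_rev:
  assumes l: "ptime \<alpha> (enc_list \<beta>) l"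
  shows "ptime \<alpha> (enc_list \<beta>) (\<lambda>x. rev (l x))"
proof -
  have "ptime \<alpha> (enc_list \<beta>) (\<lambda>x. para (\<lambda>y ys a. a @ [y]) [] (l x))"
    by (rule ptime_para[OF l ptime_Nil]; (rule ptime_append ptime_basic)+)
  moreover have "para (\<lambda>y ys a. a @ [y]) [] l = rev l" for l :: "'b list"
    by (induction l) auto
  ultimately show ?thesis
    by (simp only:)
qed

lemma ptime_concat_map:
  assumes l: "ptime \<alpha> (enc_list \<beta>) l"
    and f: "ptime (enc_pair \<alpha> \<beta>) (enc_list \<gamma>) (\<lambda>z. f (fst z) (snd z))"
  shows "ptime \<alpha> (enc_list \<gamma>) (\<lambda>x. concat (map (f x) (l x)))"
proof -
  have "ptime \<alpha> (enc_list \<gamma>) (\<lambda>x. para (\<lambda>y ys a. f x y @ a) [] (l x))"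
    by (rule ptime_para[OF l ptime_Nil]; (rule ptime_append ptime_basic ptime_comp2[where h = f, OF f])+)
  moreover have "para (\<lambda>y ys a. f x y @ a) [] l = concat (map (f x) l)" for x l
    by (induction l) auto
  ultimately show ?thesis
    by (simp only:)
qed

text \<open>To be read as a calculus: repeated application of \<open>rule\<close> peels off the
  outermost operation of a function body until only projections of the input are left.\<close>

lemmas ptime_intros = ptime_append ptime_map ptime_filter ptime_all ptime_sum_list ptime_prod_list
  ptime_rev ptime_concat_map ptime_case_list ptime_basic

section \<open>The algorithm\<close>

text \<open>
  A client is represented by the path from its location up to the depot, a list of tree arcs
  (directed away from the depot) with their scaled lengths.
\<close>

type_synonym tree_arc = "(nat \<times> nat) \<times> int"
type_synonym tree_path = "tree_arc list"

text \<open>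
  The machine has no division, so lengths are brought to a common denominator by multiplying each
  numerator with the denominators of all other arcs.
\<close>

definition scaled :: "((nat \<times> nat) \<times> int \<times> int) list \<Rightarrow> tree_arc list" where
  "scaled as = map (\<lambda>e. (fst e,
     fst (snd e) * (\<Prod>e'\<leftarrow>as. if fst e' = fst e then 1 else snd (snd e')))) as"

definition denom :: "((nat \<times> nat) \<times> int \<times> int) list \<Rightarrow> int" where
  "denom as = (\<Prod>e\<leftarrow>as. snd (snd e))"

definition first :: "'a list list \<Rightarrow> 'a list" where
  "first ps = (case ps of [] \<Rightarrow> [] | p # _ \<Rightarrow> p)"

definition lookup :: "(nat \<times> tree_path) list \<Rightarrow> nat \<Rightarrow> tree_path" where
  "lookup tb v = first (map snd (filter (\<lambda>q. fst q = v) tb))"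

text \<open>An arc enters only from a known tail to a new head. So each vertex gets a single entry,
  and of the two arcs of an edge at most the one leading away from the depot is used.\<close>

definition extend :: "tree_arc \<Rightarrow> (nat \<times> tree_path) list \<Rightarrow> (nat \<times> tree_path) list" where
  "extend e tb = (if fst (fst e) \<in> set (map fst tb) \<and> snd (fst e) \<notin> set (map fst tb)
     then (snd (fst e), e # lookup tb (fst (fst e))) # tb else tb)"

text \<open>The list \<open>vs\<close> acts as a counter: one pass over all arcs per vertex is
  enough, as every pass reaches a new vertex unless all are known.\<close>

definition table :: "nat list \<Rightarrow> tree_arc list \<Rightarrow> nat \<Rightarrow> (nat \<times> tree_path) list" where
  "table vs as r = foldr extend (concat (map (\<lambda>_. as) vs)) [(r, [])]"

text \<open>For two upward paths in a tree this is a prefix of \<open>p\<close>, namely the climb to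
  the lowest common ancestor.\<close>

definition path_diff :: "tree_path \<Rightarrow> tree_path \<Rightarrow> tree_path" where
  "path_diff p q = filter (\<lambda>e. e \<notin> set q) p"

definition weight :: "tree_path \<Rightarrow> int" where
  "weight p = (\<Sum>e\<leftarrow>p. snd e)"

definition delta :: "tree_path \<Rightarrow> tree_path \<Rightarrow> int" where
  "delta p q = weight (path_diff p q)"

definition nearest :: "tree_path \<Rightarrow> tree_path list \<Rightarrow> tree_path \<Rightarrow> bool" where
  "nearest c L l \<longleftrightarrow> (\<forall>l' \<in> set L. delta c l \<le> delta c l')"

definition place :: "tree_path \<Rightarrow> tree_path list \<Rightarrow> tree_path list" where
  "place c L = takeWhile (\<lambda>l. \<not> nearest c L l) L @ c # dropWhile (\<lambda>l. \<not> nearest c L l) L"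

text \<open>\<open>foldr\<close> consumes its list from the right, so ascending order makes the
  deepest client the first one to be placed.\<close>

definition arrange :: "tree_path list \<Rightarrow> tree_path list" where
  "arrange cs = foldr place (sort_key weight cs) []"

primrec cost :: "tree_path list \<Rightarrow> int" where
  "cost [] = 0"
| "cost (p # ps) = (if ps = [] then 0 else delta p (first ps) + cost ps)"

text \<open>A group may be served by one walk if \<open>D\<close> times its cost is at most \<open>K\<close>.\<close>

primrec groups :: "int \<Rightarrow> int \<Rightarrow> tree_path list \<Rightarrow> tree_path list list" where
  "groups K D [] = []"
| "groups K D (p # ps) = (case groups K D ps of [] \<Rightarrow> [[p]]
     | g # G \<Rightarrow> if D * cost (p # g) \<le> K then (p # g) # G else [p] # g # G)"

text \<open>Arcs point away from the depot while paths are listed upwards. A climb therefore swaps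
  every arc and keeps the order, and a descent keeps the arcs and reverses the order.\<close>

primrec walk :: "tree_path list \<Rightarrow> (nat \<times> nat) list" where
  "walk [] = []"
| "walk (p # ps) = (if ps = [] then [] else
     map (\<lambda>e. (snd (fst e), fst (fst e))) (path_diff p (first ps)) @
     rev (map fst (path_diff (first ps) p)) @ walk ps)"

definition tour :: "tree_path list \<Rightarrow> (nat \<times> nat) list" where
  "tour ps = rev (map fst (first ps)) @ walk ps"

type_synonym input =
  "nat list \<times> ((nat \<times> nat) \<times> int \<times> int) list \<times> nat \<times> nat list \<times> int \<times> int"

text \<open>The two numbers passed to \<open>groups\<close> express, without division, that twice
  the scaled cost is at most the scaled bound \<open>denom as * num / den\<close>. The argument
  \<open>D\<close> of \<open>groups\<close> is thus not the cap of the analysis; the cap is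
  \<open>K div D + 1\<close>.\<close>

definition routes :: "input \<Rightarrow> (nat \<times> nat) list list" where
  "routes = (\<lambda>(vs, as, r, cs, num, den). map tour
     (groups (num * denom as) (2 * den) (arrange (map (lookup (table vs (scaled as) r)) cs))))"

section \<open>The algorithm runs in polynomial time\<close>

abbreviation "enc_arc \<equiv> enc_pair enc_nat enc_nat"
abbreviation "enc_tree_arc \<equiv> enc_pair enc_arc VInt"
abbreviation "enc_path \<equiv> enc_list enc_tree_arc"
abbreviation "enc_table \<equiv> enc_list (enc_pair enc_nat enc_path)"
abbreviation "enc_rat_arcs \<equiv> enc_list (enc_pair enc_arc (enc_pair VInt VInt))"
abbreviation "enc_input \<equiv> enc_pair (enc_list enc_nat) (enc_pair enc_rat_arcs
  (enc_pair enc_nat (enc_pair (enc_list enc_nat) (enc_pair VInt VInt))))"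

lemma ptime_scaled: "ptime enc_rat_arcs (enc_list enc_tree_arc) scaled"
  unfolding scaled_def prod_eq_iff by (rule ptime_intros)+

lemma ptime_denom: "ptime enc_rat_arcs VInt denom"
  unfolding denom_def by (rule ptime_intros)+

lemma ptime_first:
  assumes "ptime \<alpha> (enc_list (enc_list \<beta>)) f"
  shows "ptime \<alpha> (enc_list \<beta>) (\<lambda>x. first (f x))"
  unfolding first_def by (rule assms ptime_intros)+

lemma ptime_eq_Nil:
  assumes "ptime \<alpha> (enc_list \<beta>) f"
  shows "ptime \<alpha> enc_bool (\<lambda>x. f x = [])"
proof -
  have "ptime \<alpha> enc_bool (\<lambda>x. case f x of [] \<Rightarrow> True | _ # _ \<Rightarrow> False)"
    by (rule assms ptime_intros)+
  then show ?thesis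
    by (rule ptime_cong) (auto split: list.split)
qed

lemma ptime_lookup_aux: "ptime (enc_pair enc_table enc_nat) enc_path (\<lambda>z. lookup (fst z) (snd z))"
  unfolding lookup_def by (rule ptime_first ptime_intros)+

lemmas ptime_lookup = ptime_comp2[where h = lookup, OF ptime_lookup_aux]

lemma ptime_mem_nat_aux:
  "ptime (enc_pair enc_nat (enc_list enc_nat)) enc_bool (\<lambda>z. \<not> (\<forall>y \<in> set (snd z). fst z \<noteq> y))"
  by (rule ptime_intros)+

lemma ptime_mem_nat:
  assumes "ptime \<alpha> enc_nat f" "ptime \<alpha> (enc_list enc_nat) g"
  shows "ptime \<alpha> enc_bool (\<lambda>x. f x \<in> set (g x))"
  by (rule ptime_cong[OF ptime_comp2[OF ptime_mem_nat_aux assms]]) auto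

lemma ptime_extend_aux:
  "ptime (enc_pair enc_tree_arc enc_table) enc_table (\<lambda>z. extend (fst z) (snd z))"
  unfolding extend_def by (rule ptime_lookup ptime_mem_nat ptime_intros)+

lemmas ptime_extend = ptime_comp2[where h = extend, OF ptime_extend_aux]

lemma ptime_mem_tree_arc_aux:
  "ptime (enc_pair enc_tree_arc enc_path) enc_bool (\<lambda>z. \<not> (\<forall>y \<in> set (snd z).
    \<not> (fst (fst y) = fst (fst (fst z)) \<and> snd (fst y) = snd (fst (fst z)) \<and>
      snd y \<le> snd (fst z) \<and> snd (fst z) \<le> snd y)))"
  by (rule ptime_intros)+

lemma ptime_mem_tree_arc:
  assumes "ptime \<alpha> enc_tree_arc f" "ptime \<alpha> enc_path g"
  shows "ptime \<alpha> enc_bool (\<lambda>x. f x \<in> set (g x))"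
proof -
  have eq: "e \<in> set l \<longleftrightarrow> \<not> (\<forall>y \<in> set l. \<not> (fst (fst y) = fst (fst e) \<and> snd (fst y) = snd (fst e) \<and>
      snd y \<le> snd e \<and> snd e \<le> snd y))" for e :: tree_arc and l
    by (metis order_antisym order_refl prod.expand)
  show ?thesis
    by (rule ptime_cong[OF ptime_comp[OF ptime_mem_tree_arc_aux ptime_pair[OF assms]]])
      (simp_all only: fst_conv snd_conv eq[symmetric])
qed

lemma ptime_path_diff_aux: "ptime (enc_pair enc_path enc_path) enc_path (\<lambda>z. path_diff (fst z) (snd z))"
  unfolding path_diff_def by (rule ptime_mem_tree_arc ptime_intros)+

lemmas ptime_path_diff = ptime_comp2[where h = path_diff, OF ptime_path_diff_aux]

lemma ptime_weight_aux: "ptime enc_path VInt weight"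
  unfolding weight_def by (rule ptime_intros)+

lemmas ptime_weight = ptime_comp[OF ptime_weight_aux]

lemma ptime_delta_aux: "ptime (enc_pair enc_path enc_path) VInt (\<lambda>z. delta (fst z) (snd z))"
  unfolding delta_def by (rule ptime_weight ptime_path_diff ptime_intros)+

lemmas ptime_delta = ptime_comp2[where h = delta, OF ptime_delta_aux]

lemma ptime_place_aux:
  "ptime (enc_pair enc_path (enc_list enc_path)) (enc_list enc_path) (\<lambda>z. place (fst z) (snd z))"
proof -
  let ?\<alpha> = "enc_pair (enc_pair enc_path (enc_list enc_path)) enc_path"
  have "ptime ?\<alpha> enc_bool (\<lambda>z. nearest (fst (fst z)) (snd (fst z)) (snd z))"
    unfolding nearest_def by (rule ptime_delta ptime_intros)+
  note nearest = ptime_comp2[where h = "\<lambda>x y. nearest (fst x) (snd x) y", OF this]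
  let ?P = "\<lambda>z l. \<not> nearest (fst z) (snd z) l"
  \<comment> \<open>\<open>takeWhile\<close> and \<open>dropWhile\<close> as list recursions. The
    branch that stops returns \<open>[]\<close> or \<open>y # ys\<close> and ignores the
    accumulator, so \<open>growth_const\<close> applies to it.\<close>
  have "ptime (enc_pair enc_path (enc_list enc_path)) (enc_list enc_path) (\<lambda>z.
      para (\<lambda>y ys a. if \<not> nearest (fst z) (snd z) y then y # a else []) [] (snd z) @ fst z #
      para (\<lambda>y ys a. if \<not> nearest (fst z) (snd z) y then a else y # ys) [] (snd z))"
    by (rule nearest ptime_para growth_const[where f = "\<lambda>x. []"]
        growth_const[where f = "\<lambda>x. f x # g x" for f g] ptime_intros)+
  moreover have "para (\<lambda>y ys a. if \<not> nearest p L y then y # a else []) [] l =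
      takeWhile (\<lambda>l. \<not> nearest p L l) l"
    "para (\<lambda>y ys a. if \<not> nearest p L y then a else y # ys) [] l =
      dropWhile (\<lambda>l. \<not> nearest p L l) l" for p L l
    by (induction l) auto
  ultimately show ?thesis
    by (simp only: place_def)
qed

lemma ptime_insort_aux:
  "ptime (enc_pair enc_path (enc_list enc_path)) (enc_list enc_path)
    (\<lambda>z. insort_key weight (fst z) (snd z))"
proof -
  have "ptime (enc_pair enc_path (enc_list enc_path)) (enc_list enc_path) (\<lambda>z.
      para (\<lambda>y ys a. if weight (fst z) \<le> weight y then fst z # y # ys else y # a) [fst z] (snd z))"
    by (rule ptime_para ptime_weight growth_const[where f = "\<lambda>x. f x # g x # h x" for f g h] ptime_intros)+
  moreover have "para (\<lambda>y ys a. if weight p \<le> weight y then p # y # ys else y # a) [p] l =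
      insort_key weight p l" for p l
    by (induction l) auto
  ultimately show ?thesis
    by (simp only:)
qed

lemma enc_list_sum: "vsize (enc_list \<beta> xs) = (\<Sum>x\<leftarrow>xs. vsize (\<beta> x) + 1) + vsize (VInt 0)"
  by (induction xs) auto

lemma vsize_mset: "mset xs = mset ys \<Longrightarrow> vsize (enc_list \<beta> xs) = vsize (enc_list \<beta> ys)"
  unfolding enc_list_sum sum_mset_sum_list[symmetric] mset_map by simp

lemma foldr_eq_para: "foldr f xs i = para (\<lambda>y ys a. f y a) i xs"
  by (induction xs) auto

text \<open>Placing and sorting only permute paths, and the size of an encoded list depends only on
  its multiset. So the accumulator is never larger than the list traversed.\<close>

lemma ptime_arrange: "ptime (enc_list enc_path) (enc_list enc_path) arrange"
proof -
  have mset_place: "mset (place c L) = add_mset c (mset L)" for c L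
  proof -
    have "mset (takeWhile P L) + mset (dropWhile P L) = mset L" for P
      by (metis mset_append takeWhile_dropWhile_id)
    then show ?thesis
      by (simp add: place_def)
  qed
  have foldr_vsize: "vsize (enc_list enc_path (foldr f l [])) \<le> vsize (enc_list enc_path l)"
    if "\<And>c L. mset (f c L) = add_mset c (mset L)" for f and l :: "tree_path list"
  proof -
    have "mset (foldr f l []) = mset l"
      by (induction l) (auto simp: that)
    from vsize_mset[OF this] show ?thesis
      by simp
  qed
  have foldr: "ptime \<alpha> (enc_list enc_path) (\<lambda>x. foldr f (l x) [])"
    if f: "ptime (enc_pair enc_path (enc_list enc_path)) (enc_list enc_path) (\<lambda>z. f (fst z) (snd z))"
      and l: "ptime \<alpha> (enc_list enc_path) l"
      and mset: "\<And>c L. mset (f c L) = add_mset c (mset L)" for \<alpha> :: "tree_path list \<Rightarrow> val" and f l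
    unfolding foldr_eq_para
  proof (rule ptime_para_bounded[where b = "\<lambda>n. n", OF l ptime_Nil])
    show "vsize (enc_list enc_path (para (\<lambda>y ys a. f y a) [] ys)) \<le> vsize (\<alpha> x) + vsize (enc_list enc_path ys)"
      for x ys
      using foldr_vsize[of f ys, OF mset] unfolding foldr_eq_para by simp
  qed (rule ptime_comp2[where h = f, OF f] ptime_intros polyb_id)+
  show ?thesis
    unfolding arrange_def sort_key_def
    by (rule foldr ptime_place_aux ptime_insort_aux ptime_id mset_place mset_insort)+
qed

lemma ptime_cost_aux: "ptime (enc_list enc_path) VInt cost"
proof -
  have "ptime (enc_list enc_path) VInt
      (\<lambda>l. para (\<lambda>p ps a. if ps = [] then 0 else delta p (first ps) + a) 0 l)"
    by (rule ptime_para ptime_delta ptime_first ptime_eq_Nil growth_const[OF ptime_int] ptime_intros)+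
  moreover have "para (\<lambda>p ps a. if ps = [] then 0 else delta p (first ps) + a) 0 l = cost l" for l
    by (induction l) auto
  ultimately show ?thesis
    by (simp only:)
qed

lemmas ptime_cost = ptime_comp[OF ptime_cost_aux]

lemma ptime_groups_aux:
  "ptime (enc_pair (enc_pair VInt VInt) (enc_list enc_path)) (enc_list (enc_list enc_path))
    (\<lambda>z. groups (fst (fst z)) (snd (fst z)) (snd z))"
proof -
  let ?\<alpha> = "enc_pair (enc_pair VInt VInt) (enc_list enc_path)"
  define step :: "int \<Rightarrow> int \<Rightarrow> tree_path \<Rightarrow> tree_path list \<Rightarrow> tree_path list list \<Rightarrow> _" where
    "step K D p ps a = (case a of [] \<Rightarrow> [[p]]
      | g # G \<Rightarrow> if D * cost (p # g) \<le> K then (p # g) # G else [p] # g # G)" for K D p ps a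
  have growth: "growth (enc_pair ?\<alpha> (enc_pair enc_path (enc_list enc_path))) (enc_list (enc_list enc_path))
      (\<lambda>z a. step (fst (fst (fst z))) (snd (fst (fst z))) (fst (snd z)) (snd (snd z)) a)"
  proof (rule growthI[where b = "\<lambda>n. n + 5"])
    show "vsize (enc_list (enc_list enc_path) (step (fst (fst (fst z))) (snd (fst (fst z))) (fst (snd z)) (snd (snd z)) a))
      \<le> vsize (enc_list (enc_list enc_path) a) +
        (vsize (enc_pair ?\<alpha> (enc_pair enc_path (enc_list enc_path)) z) + 5)" for z a
      by (cases a) (auto simp: step_def enc_pair_def floorlog_eq_zero_iff[THEN iffD2])
  qed (intro polyb_intros)
  have "ptime ?\<alpha> (enc_list (enc_list enc_path))
      (\<lambda>z. para (step (fst (fst z)) (snd (fst z))) [] (snd z))"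
    by (rule ptime_para[where g = "\<lambda>z. step (fst (fst z)) (snd (fst z))"], unfold step_def)
      (rule growth[unfolded step_def] ptime_cost ptime_intros)+
  moreover have "para (step K D) [] l = groups K D l" for K D l
    by (induction l) (simp_all add: step_def del: cost.simps)
  ultimately show ?thesis
    by (simp only:)
qed

lemma ptime_groups:
  assumes "ptime \<alpha> VInt K" "ptime \<alpha> VInt D" "ptime \<alpha> (enc_list enc_path) l"
  shows "ptime \<alpha> (enc_list (enc_list enc_path)) (\<lambda>x. groups (K x) (D x) (l x))"
  using ptime_comp[OF ptime_groups_aux ptime_pair[OF ptime_pair[OF assms(1,2)] assms(3)]] by simp

lemma ptime_walk_aux: "ptime (enc_list enc_path) (enc_list enc_arc) walk"
proof -
  define step :: "tree_path \<Rightarrow> tree_path list \<Rightarrow> (nat \<times> nat) list" where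
    "step p ps = map (\<lambda>e. (snd (fst e), fst (fst e))) (path_diff p (first ps)) @ rev (map fst (path_diff (first ps) p))"
    for p ps
  have "ptime (enc_pair enc_path (enc_list enc_path)) (enc_list enc_arc) (\<lambda>z. step (fst z) (snd z))"
    unfolding step_def by (rule ptime_path_diff ptime_first ptime_intros)+
  note step = ptime_comp2[where h = step, OF this]
  have "ptime (enc_list enc_path) (enc_list enc_arc)
      (\<lambda>l. para (\<lambda>p ps a. if ps = [] then [] else step p ps @ a) [] l)"
    by (rule ptime_para step ptime_eq_Nil growth_const[OF ptime_Nil] ptime_intros)+
  moreover have "para (\<lambda>p ps a. if ps = [] then [] else step p ps @ a) [] l = walk l" for l
    by (induction l) (simp_all only: para.simps walk.simps step_def append_assoc)
  ultimately show ?thesis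
    by (simp only:)
qed

lemma ptime_tour:
  assumes "ptime \<alpha> (enc_list enc_path) f"
  shows "ptime \<alpha> (enc_list enc_arc) (\<lambda>x. tour (f x))"
  unfolding tour_def by (rule ptime_comp[OF ptime_walk_aux] assms ptime_first ptime_intros)+

lemma lookup_cases: "lookup tb v = [] \<or> (v, lookup tb v) \<in> set tb"
proof (cases "filter (\<lambda>q. fst q = v) tb")
  case (Cons q qs)
  then have "q \<in> set (filter (\<lambda>q. fst q = v) tb)"
    by simp
  then have "q \<in> set tb" "fst q = v"
    by auto
  with Cons show ?thesis
    by (auto simp: lookup_def first_def)
qed (simp add: lookup_def first_def)

text \<open>\<open>extend\<close> may copy a path already in the table, so its increase depends on
  the accumulator and \<open>growth\<close> cannot be used. What saves the bound is that the arcs of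
  every stored path are taken from distinct positions of the list processed so far.\<close>

lemma extend_entry:
  assumes "(v, p) \<in> set (foldr extend xs [(r, [])])"
  shows "vsize (enc_nat v) \<le> vsize (enc_nat r) + vsize (enc_list enc_tree_arc xs)"
    "vsize (enc_path p) \<le> vsize (enc_list enc_tree_arc xs)"
proof -
  have "vsize (enc_nat v) \<le> vsize (enc_nat r) + vsize (enc_list enc_tree_arc xs) \<and>
    vsize (enc_path p) \<le> vsize (enc_list enc_tree_arc xs)"
    using assms
  proof (induction xs arbitrary: v p)
    case (Cons e xs)
    let ?tb = "foldr extend xs [(r, [])]"
    have "vsize (enc_path (lookup ?tb u)) \<le> vsize (enc_list enc_tree_arc xs)" for u
      using lookup_cases[of ?tb u] Cons.IH[of u "lookup ?tb u"] vsize_pos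
      by (auto simp: floorlog_eq_zero_iff[THEN iffD2])
    then show ?case
      using Cons by (cases e) (fastforce simp: extend_def split: if_splits)
  qed auto
  then show "vsize (enc_nat v) \<le> vsize (enc_nat r) + vsize (enc_list enc_tree_arc xs)"
    "vsize (enc_path p) \<le> vsize (enc_list enc_tree_arc xs)"
    by auto
qed

lemma vsize_extend:
  assumes "vsize (enc_nat r) + vsize (enc_list enc_tree_arc xs) \<le> n"
  shows "vsize (enc_table (foldr extend xs [(r, [])])) \<le> (n + 1) * (2 * n + 2) + 1"
proof -
  let ?tb = "foldr extend xs [(r, [])]"
  have "length ?tb \<le> length xs + 1"
    by (induction xs) (auto simp: extend_def)
  then have len: "length ?tb \<le> n + 1"
    using assms length_le_vsize[of xs enc_tree_arc] by linarith
  have "vsize (enc_pair enc_nat enc_path x) + 1 \<le> 2 * n + 2" if "x \<in> set ?tb" for x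
    using extend_entry[of "fst x" "snd x" xs r] that assms by (simp add: enc_pair_def)
  then have "(\<Sum>x\<leftarrow>?tb. vsize (enc_pair enc_nat enc_path x) + 1) \<le> (\<Sum>x\<leftarrow>?tb. 2 * n + 2)"
    by (intro sum_list_mono)
  also have "\<dots> = length ?tb * (2 * n + 2)"
    by (simp add: sum_list_triv)
  also have "\<dots> \<le> (n + 1) * (2 * n + 2)"
    using len by (intro mult_right_mono) auto
  finally show ?thesis
    unfolding enc_list_sum by (simp add: floorlog_eq_zero_iff[THEN iffD2])
qed

lemma ptime_table:
  assumes vs: "ptime \<alpha> (enc_list enc_nat) vs" and as: "ptime \<alpha> (enc_list enc_tree_arc) as"
    and r: "ptime \<alpha> enc_nat r"
  shows "ptime \<alpha> enc_table (\<lambda>x. table (vs x) (as x) (r x))"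
proof -
  let ?\<beta> = "enc_pair enc_nat (enc_list enc_tree_arc)"
  have "ptime ?\<beta> enc_table (\<lambda>z. para (\<lambda>y ys a. extend y a) [(fst z, [])] (snd z))"
  proof (rule ptime_para_bounded[where b = "\<lambda>n. (n + 1) * (2 * n + 2) + 1"])
    fix z :: "nat \<times> tree_arc list" and ys :: "tree_arc list"
    have "vsize (enc_nat (fst z)) \<le> vsize (?\<beta> z)"
      by (simp add: enc_pair_def)
    then show "vsize (enc_table (para (\<lambda>y ys a. extend y a) [(fst z, [])] ys)) \<le>
        ((vsize (?\<beta> z) + vsize (enc_list enc_tree_arc ys)) + 1) *
        (2 * (vsize (?\<beta> z) + vsize (enc_list enc_tree_arc ys)) + 2) + 1"
      using vsize_extend[of "fst z" ys "vsize (?\<beta> z) + vsize (enc_list enc_tree_arc ys)"]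
      unfolding foldr_eq_para by simp
  qed (rule ptime_extend ptime_intros polyb_intros)+
  note * = ptime_comp2[where h = "\<lambda>r l. para (\<lambda>y ys a. extend y a) [(r, [])] l", OF this]
  let ?\<gamma> = "enc_pair (enc_list enc_nat) (enc_pair (enc_list enc_tree_arc) enc_nat)"
  have "ptime ?\<gamma> enc_table (\<lambda>x. table (fst x) (fst (snd x)) (snd (snd x)))"
    unfolding table_def foldr_eq_para by (rule * ptime_intros)+
  from ptime_comp[OF this ptime_pair[OF vs ptime_pair[OF as r]]] show ?thesis
    by simp
qed

lemma ptime_routes: "ptime enc_input (enc_list (enc_list enc_arc)) routes"
  unfolding routes_def case_prod_unfold
  by (rule ptime_tour ptime_groups ptime_lookup ptime_table ptime_comp[OF ptime_arrange]
      ptime_comp[OF ptime_scaled] ptime_comp[OF ptime_denom] ptime_intros)+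

lemma ptime_program:
  assumes "ptime \<alpha> \<beta> f"
  obtains P and q :: "nat poly" where
    "\<And>x. \<exists>t. runs_in P (\<alpha> x) (\<beta> (f x)) t \<and> t \<le> poly q (vsize (\<alpha> x))"
proof -
  obtain P\<^sub>0 d k where "realizes P\<^sub>0 d k \<alpha> \<beta> f"
    using assms unfolding ptime_def by blast
  moreover define P where "P = [shift 1 d] @ map (shift 1) P\<^sub>0"
  ultimately have P: "realizes P (P ! 0) k \<alpha> \<beta> f"
    using realizes_embed[where A = "[shift 1 d]" and B = "[]" and P = P\<^sub>0] by simp
  have "polyb (\<lambda>n. 1 + n + (n + 2) ^ k + 1 + (n + 2) ^ k)"
    by (intro polyb_intros)
  then obtain l where l: "\<And>n :: nat. 1 + n + (n + 2) ^ k + 1 + (n + 2) ^ k \<le> (n + 2) ^ l"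
    unfolding polyb_def by blast
  show ?thesis
  \<comment> \<open>\<open>[:2, 1:]\<close> is the polynomial \<open>n + 2\<close>.\<close>
  proof (rule that[of P "[:2, 1:] ^ l"])
    fix x
    obtain t where t: "eval P [\<alpha> x] (P ! 0) (\<beta> (f x)) t" "t \<le> (vsize (\<alpha> x) + 2) ^ k"
      using realizesE[OF P] .
    have "runs_in P (\<alpha> x) (\<beta> (f x)) (1 + vsize (\<alpha> x) + t + 1 + vsize (\<beta> (f x)))"
      unfolding runs_in_def by (rule eval.Call[OF eval_Var0 _ t(1)]) (simp add: P_def)
    moreover have "1 + vsize (\<alpha> x) + t + 1 + vsize (\<beta> (f x)) \<le> poly ([:2, 1:] ^ l) (vsize (\<alpha> x))"
      using l[of "vsize (\<alpha> x)"] t(2) eval_vsize[OF t(1)] by (simp add: poly_power add.commute)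
    ultimately show "\<exists>t. runs_in P (\<alpha> x) (\<beta> (f x)) t \<and> t \<le> poly ([:2, 1:] ^ l) (vsize (\<alpha> x))"
      by blast
  qed
qed

section \<open>Combinatorics of tree paths\<close>

text \<open>
  A set of paths forms a tree if the part of a path above one of its arcs depends only on that
  arc; \<open>rest e\<close> is the path above \<open>e\<close>.
\<close>

locale tree_paths =
  fixes rest :: "tree_arc \<Rightarrow> tree_path"
begin

primrec good :: "tree_path \<Rightarrow> bool" where
  "good [] \<longleftrightarrow> True"
| "good (e # p) \<longleftrightarrow> rest e = p \<and> e \<notin> set p \<and> 0 \<le> snd e \<and> good p"

end

lemma weight_simps [simp]: "weight [] = 0" "weight (e # p) = snd e + weight p"
  "weight (p @ q) = weight p + weight q"
  by (simp_all add: weight_def)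

lemma path_diff_simps [simp]: "path_diff [] q = []"
  "path_diff (e # p) q = (if e \<in> set q then path_diff p q else e # path_diff p q)"
  by (simp_all add: path_diff_def)

context tree_paths
begin

lemma good_distinct: "good p \<Longrightarrow> distinct p"
  by (induction p) auto

lemma good_appendD: "good (p @ q) \<Longrightarrow> good q"
  by (induction p) auto

lemma good_split:
  assumes "good p" "e \<in> set p"
  obtains q where "p = q @ e # rest e" "good (e # rest e)"
proof -
  obtain q r where p: "p = q @ e # r"
    using assms(2) by (meson split_list)
  then have "good (e # r)"
    using assms(1) good_appendD by blast
  then show ?thesis
    using that p by auto
qed

lemma good_nonneg: "good p \<Longrightarrow> e \<in> set p \<Longrightarrow> 0 \<le> snd e"
  by (induction p) auto

lemma weight_prefix_nonneg: "good (p @ q) \<Longrightarrow> 0 \<le> weight p"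
  by (induction p) auto

lemma path_diff_Nil: "path_diff p [] = p"
  by (simp add: path_diff_def)

text \<open>Once two upward paths share an arc, \<open>rest\<close> makes them agree from there on.
  The common suffix \<open>c\<close> is the path of the lowest common ancestor.\<close>

lemma path_diff_decomp:
  assumes "good p" "good q"
  obtains c where "p = path_diff p q @ c" "q = path_diff q p @ c"
proof -
  have "\<exists>c. p = path_diff p q @ c \<and> q = path_diff q p @ c"
    using assms(1)
  proof (induction p)
    case Nil
    then show ?case
      by (simp add: path_diff_Nil)
  next
    case (Cons e r)
    show ?case
    proof (cases "e \<in> set q")
      case True
      then obtain q' where q: "q = q' @ e # r"
        using good_split[OF assms(2)] Cons.prems by (metis good.simps(2))
      have "path_diff (e # r) q = []"
        unfolding path_diff_def filter_empty_conv q by auto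
      moreover have "path_diff q (e # r) = q'"
      proof -
        have "distinct q"
          using good_distinct[OF assms(2)] .
        then have "\<forall>x \<in> set q'. x \<notin> set (e # r)"
          unfolding q by auto
        then have "filter (\<lambda>x. x \<notin> set (e # r)) q' = q'"
          by (simp only: filter_id_conv)
        then show ?thesis
          unfolding path_diff_def q filter_append by (simp add: filter_empty_conv)
      qed
      ultimately show ?thesis
        using q by simp
    next
      case False
      then have "path_diff q (e # r) = path_diff q r"
        unfolding path_diff_def by (intro filter_cong) auto
      moreover have "good r"
        using Cons.prems by simp
      then obtain c where "r = path_diff r q @ c" "q = path_diff q r @ c"
        using Cons.IH by blast
      moreover have "path_diff (e # r) q @ c = e # (path_diff r q @ c)"
        using False by simp
      ultimately show ?thesis
        by metis
    qed
  qed
  then show ?thesis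
    using that by blast
qed

section \<open>Depths of lowest common ancestors and their ultrametric inequality\<close>

definition meet :: "tree_path \<Rightarrow> tree_path \<Rightarrow> int" where
  "meet p q = weight p - delta p q"

lemma meet_sym: "good p \<Longrightarrow> good q \<Longrightarrow> meet p q = meet q p"
proof -
  assume "good p" "good q"
  then obtain c where "p = path_diff p q @ c" "q = path_diff q p @ c"
    by (rule path_diff_decomp)
  then show ?thesis
    unfolding meet_def delta_def by (metis add_diff_cancel_left' weight_simps(3))
qed

lemma weight_path_diff_nonneg: "good p \<Longrightarrow> 0 \<le> weight (path_diff p q)"
  by (induction p) auto

lemma delta_nonneg: "good p \<Longrightarrow> 0 \<le> delta p q"
  unfolding delta_def by (rule weight_path_diff_nonneg)

text \<open>Only an inequality, because \<open>a\<close> and \<open>b\<close> may share further arcs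
  below \<open>c\<close>.\<close>

lemma common_suffix_le_meet:
  assumes "good (a @ c)"
  shows "weight c \<le> meet (a @ c) (b @ c)"
proof -
  have "path_diff c (b @ c) = []"
    unfolding path_diff_def by (auto simp: filter_empty_conv)
  then have "path_diff (a @ c) (b @ c) = path_diff a (b @ c)"
    unfolding path_diff_def by simp
  moreover have "weight (path_diff a q) \<le> weight a" for q
    using assms by (induction a) auto
  ultimately show ?thesis
    unfolding meet_def delta_def by simp
qed

text \<open>The common parts \<open>c\<close> of \<open>x\<close>, \<open>y\<close> and
  \<open>d\<close> of \<open>y\<close>, \<open>z\<close> are both suffixes of \<open>y\<close>,
  hence comparable. The shorter of them is a suffix of both \<open>x\<close> and
  \<open>z\<close>.\<close>

lemma meet_ultrametric:
  assumes "good x" "good y" "good z"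
  shows "min (meet x y) (meet y z) \<le> meet x z"
proof -
  obtain c where c: "x = path_diff x y @ c" "y = path_diff y x @ c"
    using path_diff_decomp[OF assms(1,2)] .
  obtain d where d: "y = path_diff y z @ d" "z = path_diff z y @ d"
    using path_diff_decomp[OF assms(2,3)] .
  have w: "weight c = meet x y" "weight d = meet y z"
    using c(1) d(1) unfolding meet_def delta_def by (metis add_diff_cancel_left' weight_simps(3))+
  have "path_diff y x @ c = path_diff y z @ d"
    using c(2) d(1) by simp
  then consider u where "c = u @ d" | u where "d = u @ c"
    by (auto simp: append_eq_append_conv2)
  then show ?thesis
  proof cases
    case 1
    then have "x = (path_diff x y @ u) @ d"
      using c(1) by simp
    then show ?thesis
      using common_suffix_le_meet[of "path_diff x y @ u" d "path_diff z y"] assms(1) d(2) w by fastforce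
  next
    case 2
    then have "z = (path_diff z y @ u) @ c"
      using d(2) by simp
    then show ?thesis
      using common_suffix_le_meet[of "path_diff x y" c "path_diff z y @ u"] assms(1) c(1) w by fastforce
  qed
qed

text \<open>Among three meets the two smallest are equal. If \<open>c\<close> stays with
  \<open>l\<close> longer than with \<open>a\<close>, then \<open>a\<close> leaves both at the same
  vertex.\<close>

lemma delta_eq_if_closer:
  assumes "good a" "good c" "good l" "delta c l < delta c a"
  shows "delta a c = delta a l"
proof -
  have "meet c a < meet c l"
    using assms(4) unfolding meet_def by simp
  then have "meet a c < meet l c"
    using assms meet_sym by metis
  then have "meet a c = meet a l"
    using meet_ultrametric[OF assms(1,3,2)] meet_ultrametric[OF assms(1,2,3)] meet_sym[OF assms(2,3)]
    by linarith
  then show ?thesis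
    unfolding meet_def by simp
qed

end

section \<open>The effect of one insertion on the capped cost\<close>

primrec capped_cost :: "int \<Rightarrow> tree_path list \<Rightarrow> int" where
  "capped_cost D [] = 0"
| "capped_cost D (p # ps) = (if ps = [] then 0 else min (delta p (first ps)) D + capped_cost D ps)"

lemma first_Cons [simp]: "first (p # ps) = p"
  by (simp add: first_def)

lemma first_append: "ps \<noteq> [] \<Longrightarrow> first (ps @ qs) = first ps"
  by (cases ps) auto

lemma capped_cost_append:
  "capped_cost D (A @ a # b # B) = capped_cost D (A @ [a]) + min (delta a b) D + capped_cost D (b # B)"
proof (induction A)
  case (Cons x A)
  have "first (A @ a # b # B) = first (A @ [a])"
    by (cases A) auto
  then show ?case
    using Cons by simp
qed simp

context tree_paths
begin

text \<open>Since \<open>l\<close> is the first minimiser, its predecessor \<open>a\<close> is not a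
  minimiser, which is exactly the strict inequality that \<open>delta_eq_if_closer\<close> asks
  for.\<close>

lemma capped_cost_place:
  assumes "\<forall>l \<in> set L. good l" "good c" "L \<noteq> []" "0 \<le> D"
  obtains l where "l \<in> set L" "nearest c L l"
    "capped_cost D (place c L) = capped_cost D L + min (delta c l) D"
proof -
  let ?P = "\<lambda>l. \<not> nearest c L l"
  let ?A = "takeWhile ?P L" and ?B = "dropWhile ?P L"
  have "finite (delta c ` set L)" "delta c ` set L \<noteq> {}"
    using assms(3) by auto
  then obtain m where m: "m \<in> set L" "delta c m = Min (delta c ` set L)"
    using Min_in by (metis (no_types, lifting) imageE)
  then have "nearest c L m"
    unfolding nearest_def by auto
  then have "?B \<noteq> []"
    using m(1) by (auto simp: dropWhile_eq_Nil_conv)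
  then obtain l B where B: "?B = l # B"
    by (cases ?B) auto
  then have l: "nearest c L l" "l \<in> set L"
    by (metis dropWhile_eq_Cons_conv) (metis B list.set_intros(1) set_dropWhileD)
  have L: "L = ?A @ l # B"
    using B by (metis takeWhile_dropWhile_id)
  have place: "place c L = ?A @ c # l # B"
    unfolding place_def B ..
  have "capped_cost D (place c L) = capped_cost D L + min (delta c l) D"
  proof (cases ?A rule: rev_cases)
    case Nil
    then show ?thesis
      unfolding place by (subst (2) L) simp
  next
    case (snoc A a)
    then have "a \<in> set ?A"
      by simp
    then have a: "a \<in> set L" "\<not> nearest c L a"
      by (auto dest: set_takeWhileD)
    then have "delta c l < delta c a"
      using l(1) unfolding nearest_def by (metis linorder_not_le order_trans)
    then have *: "delta a c = delta a l"
      using assms a(1) l(2) by (intro delta_eq_if_closer) auto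
    have "capped_cost D (place c L) = capped_cost D (A @ [a]) + min (delta a c) D + capped_cost D (c # l # B)"
      unfolding place snoc using capped_cost_append[of D A a c "l # B"] by simp
    moreover have "capped_cost D L = capped_cost D (A @ [a]) + min (delta a l) D + capped_cost D (l # B)"
      using capped_cost_append[of D A a l B] L snoc by simp
    ultimately show ?thesis
      using * by simp
  qed
  with l that show ?thesis
    by blast
qed

end

section \<open>Charges of the covered arcs\<close>

context tree_paths
begin

text \<open>
  The charge of an arc is the part of its length that lies less than \<open>D\<close> above the deepest client
  below it. Along any path towards the depot the charges telescope to at most \<open>D\<close>.
\<close>

definition peak :: "tree_path list \<Rightarrow> tree_arc \<Rightarrow> int" where
  "peak cs e = Max (weight ` {c \<in> set cs. e \<in> set c})"

definition charge :: "int \<Rightarrow> tree_path list \<Rightarrow> tree_arc \<Rightarrow> int" where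
  "charge D cs e = min (peak cs e - weight (rest e)) D - min (peak cs e - weight (e # rest e)) D"

definition covered :: "tree_path list \<Rightarrow> tree_arc set" where
  "covered cs = \<Union> (set ` set cs)"

lemma finite_covered: "finite (covered cs)"
  unfolding covered_def by simp

lemma peak_ge: "c \<in> set cs \<Longrightarrow> e \<in> set c \<Longrightarrow> weight c \<le> peak cs e"
  unfolding peak_def by (intro Max_ge) auto

lemma peak_attained:
  assumes "e \<in> covered cs"
  obtains c where "c \<in> set cs" "e \<in> set c" "peak cs e = weight c"
proof -
  have "peak cs e \<in> weight ` {c \<in> set cs. e \<in> set c}"
    unfolding peak_def using assms by (intro Max_in) (auto simp: covered_def)
  then show ?thesis
    using that by auto
qed

lemma weight_le_peak:
  assumes "\<forall>c \<in> set cs. good c" "e \<in> covered cs"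
  shows "weight (e # rest e) \<le> peak cs e"
proof -
  obtain c where c: "c \<in> set cs" "e \<in> set c" "peak cs e = weight c"
    using peak_attained[OF assms(2)] .
  then obtain q where q: "c = q @ e # rest e"
    using good_split assms(1) by metis
  have "good c"
    using assms(1) c(1) by blast
  then have "0 \<le> weight q"
    unfolding q by (induction q) auto
  then show ?thesis
    using c(3) q by simp
qed

text \<open>A client below \<open>e\<close> is also below every arc above \<open>e\<close>.\<close>

lemma peak_rest_mono:
  assumes "\<forall>c \<in> set cs. good c" "e \<in> covered cs" "e' \<in> set (rest e)"
  shows "peak cs e \<le> peak cs e'" "e' \<in> covered cs"
proof -
  obtain c where c: "c \<in> set cs" "e \<in> set c" "peak cs e = weight c"
    using peak_attained[OF assms(2)] .
  then obtain q where "c = q @ e # rest e"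
    using good_split assms(1) by metis
  then have "e' \<in> set c"
    using assms(3) by auto
  then show "peak cs e \<le> peak cs e'" "e' \<in> covered cs"
    using peak_ge[OF c(1)] c by (auto simp: covered_def)
qed

text \<open>Truncation at \<open>D\<close> is monotone and does not expand distances, and its two
  arguments differ by \<open>snd e\<close>.\<close>

lemma charge_bounds:
  assumes "0 \<le> snd e"
  shows "0 \<le> charge D cs e" "charge D cs e \<le> snd e"
  using assms unfolding charge_def by auto

lemma covered_nonneg: "\<forall>c \<in> set cs. good c \<Longrightarrow> e \<in> covered cs \<Longrightarrow> 0 \<le> snd e"
  unfolding covered_def using good_nonneg by blast

text \<open>The terms need not cancel exactly, since the peak may grow on the way up. It never
  falls, so the term at the top of an arc is at most the term at the bottom of the next arc, and the
  sum still telescopes as an upper bound.\<close>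

lemma charge_path_covered:
  assumes "\<forall>c \<in> set cs. good c" "good (e # p)" "e \<in> covered cs" "0 \<le> D"
  shows "sum (charge D cs) (set (e # p)) \<le> D - min (peak cs e - weight (e # p)) D"
  using assms(2,3)
proof (induction p arbitrary: e)
  case Nil
  then show ?case
    by (auto simp: charge_def)
next
  case (Cons e' p)
  have rest: "rest e = e' # p"
    using Cons.prems(1) by simp
  have e': "peak cs e \<le> peak cs e'" "e' \<in> covered cs"
    using peak_rest_mono[OF assms(1) Cons.prems(2), of e'] rest by auto
  have "sum (charge D cs) (set (e' # p)) \<le> D - min (peak cs e' - weight (e' # p)) D"
    using Cons e' by simp
  moreover have "sum (charge D cs) (set (e # e' # p)) = charge D cs e + sum (charge D cs) (set (e' # p))"
    using Cons.prems(1) by (subst list.set(2), subst sum.insert) auto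
  moreover have "charge D cs e = min (peak cs e - weight (e' # p)) D - min (peak cs e - weight (e # e' # p)) D"
    unfolding charge_def rest ..
  ultimately show ?case
    using e'(1) by linarith
qed

text \<open>A walk may end below all clients, so \<open>p\<close> can begin with uncovered arcs.
  From the first covered arc on, everything above is covered.\<close>

lemma charge_path:
  assumes "\<forall>c \<in> set cs. good c" "good p" "0 \<le> D"
  shows "sum (charge D cs) (covered cs \<inter> set p) \<le> D"
  using assms(2)
proof (induction p)
  case Nil
  then show ?case
    using assms(3) by simp
next
  case (Cons e p)
  show ?case
  proof (cases "e \<in> covered cs")
    case True
    have "set (e # p) \<subseteq> covered cs"
      using peak_rest_mono(2)[OF assms(1) True] True Cons.prems by auto
    then have eq: "covered cs \<inter> set (e # p) = set (e # p)"
      by blast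
    have "0 \<le> peak cs e - weight (e # p)"
      using weight_le_peak[OF assms(1) True] Cons.prems by simp
    then have "0 \<le> min (peak cs e - weight (e # p)) D"
      using assms(3) by simp
    then show ?thesis
      using charge_path_covered[OF assms(1) Cons.prems True assms(3)] unfolding eq by linarith
  next
    case False
    then show ?thesis
      using Cons by simp
  qed
qed

text \<open>A constant peak makes the telescoping exact. In the application \<open>W\<close> is the
  weight of \<open>n @ s\<close>, and the value becomes \<open>min (weight n) D\<close>.\<close>

lemma charge_new:
  assumes "good (n @ s)" "\<And>e. e \<in> set n \<Longrightarrow> peak cs e = W"
  shows "sum (charge D cs) (set n) = min (W - weight s) D - min (W - weight (n @ s)) D"
  using assms
proof (induction n)
  case (Cons e n)
  have rest: "rest e = n @ s"
    using Cons.prems(1) by simp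
  have "sum (charge D cs) (set n) = min (W - weight s) D - min (W - weight (n @ s)) D"
    using Cons by simp
  moreover have "e \<notin> set n"
    using Cons.prems(1) by auto
  ultimately show ?case
    using Cons.prems(2)[of e] by (simp add: charge_def rest)
qed simp

lemma covered_Cons: "covered (c # cs) = covered cs \<union> set c"
  unfolding covered_def by auto

text \<open>Charges are final: a client that comes later is at most as deep as the ones before it,
  so it changes no peak of an arc already covered.\<close>

lemma peak_Cons_light:
  assumes "\<forall>c' \<in> set cs. weight c \<le> weight c'" "e \<in> covered cs"
  shows "peak (c # cs) e = peak cs e"
proof -
  have "peak (c # cs) e = Max (weight ` {c' \<in> set cs. e \<in> set c'})"
  proof (cases "e \<in> set c")
    case True
    then have "{c' \<in> set (c # cs). e \<in> set c'} = insert c {c' \<in> set cs. e \<in> set c'}"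
      by auto
    moreover obtain d where d: "d \<in> set cs" "e \<in> set d"
      using assms(2) by (auto simp: covered_def)
    moreover have "weight c \<le> Max (weight ` {c' \<in> set cs. e \<in> set c'})"
      by (rule order_trans[OF _ Max_ge[of _ "weight d"]]) (use d assms(1) in auto)
    ultimately show ?thesis
      unfolding peak_def by (simp only: image_insert, subst Max_insert) auto
  next
    case False
    then have "{c' \<in> set (c # cs). e \<in> set c'} = {c' \<in> set cs. e \<in> set c'}"
      by auto
    then show ?thesis
      unfolding peak_def by simp
  qed
  then show ?thesis
    unfolding peak_def .
qed

lemma peak_Cons_new: "e \<notin> covered cs \<Longrightarrow> e \<in> set c \<Longrightarrow> peak (c # cs) e = weight c"
proof -
  assume "e \<notin> covered cs" "e \<in> set c"
  then have "{c' \<in> set (c # cs). e \<in> set c'} = {c}"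
    by (auto simp: covered_def)
  then show ?thesis
    unfolding peak_def by simp
qed

text \<open>Being covered is inherited upwards, so the new arcs form the lower end of the
  path.\<close>

lemma split_new:
  assumes "\<forall>c \<in> set cs. good c" "good c"
  obtains n s where "c = n @ s" "set n = set c - covered cs" "set s \<subseteq> covered cs"
proof -
  have "\<exists>n s. c = n @ s \<and> set n = set c - covered cs \<and> set s \<subseteq> covered cs"
    using assms(2)
  proof (induction c)
    case (Cons e p)
    show ?case
    proof (cases "e \<in> covered cs")
      case True
      then have "set (e # p) \<subseteq> covered cs"
        using peak_rest_mono(2)[OF assms(1) True] Cons.prems by auto
      then show ?thesis
        by (intro exI[of _ "[]"] exI[of _ "e # p"]) auto
    next
      case False
      then obtain n s where "p = n @ s" "set n = set p - covered cs" "set s \<subseteq> covered cs"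
        using Cons by auto
      then show ?thesis
        using False by (intro exI[of _ "e # n"] exI[of _ s]) auto
    qed
  qed simp
  then show ?thesis
    using that by blast
qed

text \<open>Some earlier client uses the lowest covered arc of the path and hence shares all of
  \<open>s\<close>. If nothing is covered, any earlier client will do.\<close>

lemma delta_le_new:
  assumes "\<forall>c \<in> set cs. good c" "good (n @ s)" "set s \<subseteq> covered cs" "cs \<noteq> []"
  obtains l where "l \<in> set cs" "delta (n @ s) l \<le> weight n"
proof (cases s)
  case Nil
  obtain l where "l \<in> set cs"
    using assms(4) by (cases cs) auto
  moreover have "delta (n @ s) l \<le> weight (n @ s)"
    using common_suffix_le_meet[of "n @ s" "[]" l] assms(2) unfolding meet_def by simp
  ultimately show ?thesis
    using that Nil by simp
next
  case (Cons e p)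
  then obtain l where l: "l \<in> set cs" "e \<in> set l"
    using assms(3) by (auto simp: covered_def)
  have "p = rest e"
    using good_appendD[OF assms(2)] Cons by simp
  moreover obtain q where "l = q @ e # rest e"
    using good_split l assms(1) by metis
  ultimately have "l = q @ s"
    using Cons by simp
  then have "delta (n @ s) l \<le> weight n"
    using common_suffix_le_meet[OF assms(2), of q] unfolding meet_def by simp
  then show ?thesis
    using that l(1) by blast
qed

lemma set_place: "set (place c L) = insert c (set L)"
proof -
  have "set (takeWhile P L) \<union> set (dropWhile P L) = set L" for P
    by (metis set_append takeWhile_dropWhile_id)
  then show ?thesis
    unfolding place_def by auto
qed

lemma set_foldr_place: "set (foldr place cs []) = set cs"
  by (induction cs) (auto simp: set_place)

lemma capped_cost_le_charge:
  assumes "sorted (map weight cs)" "\<forall>c \<in> set cs. good c" "0 \<le> D"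
  shows "capped_cost D (foldr place cs []) \<le> sum (charge D cs) (covered cs)"
  using assms(1,2)
proof (induction cs)
  case (Cons c cs)
  let ?L = "foldr place cs []"
  have set_L: "set ?L = set cs"
    by (rule set_foldr_place)
  have light: "\<forall>c' \<in> set cs. weight c \<le> weight c'"
    using Cons.prems(1) by auto
  obtain n s where ns: "c = n @ s" "set n = set c - covered cs" "set s \<subseteq> covered cs"
    using split_new[of cs c] Cons.prems(2) by auto
  have "sum (charge D (c # cs)) (covered (c # cs)) =
      sum (charge D (c # cs)) (covered cs) + sum (charge D (c # cs)) (set n)"
    unfolding covered_Cons ns(2)
    by (subst sum.union_disjoint[symmetric]) (auto simp: finite_covered)
  moreover have "sum (charge D (c # cs)) (covered cs) = sum (charge D cs) (covered cs)"
    unfolding charge_def by (intro sum.cong refl) (simp add: peak_Cons_light[OF light])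
  moreover have "sum (charge D (c # cs)) (set n) = min (weight n) D"
  proof -
    have "peak (c # cs) e = weight c" if "e \<in> set n" for e
      using that ns(2) peak_Cons_new by blast
    moreover have "good (n @ s)"
      using Cons.prems(2) unfolding ns(1)[symmetric] by simp
    moreover have "weight c = weight n + weight s"
      using arg_cong[OF ns(1), of weight] by simp
    ultimately show ?thesis
      using charge_new[of n s "c # cs" "weight c" D] assms(3) by simp
  qed
  moreover have "capped_cost D (place c ?L) \<le> capped_cost D ?L + min (weight n) D"
  \<comment> \<open>The client placed first causes no climb at all, while its path is charged
    nevertheless.\<close>
  proof (cases "cs = []")
    case True
    have "0 \<le> weight n"
      using Cons.prems(2) ns(1) weight_prefix_nonneg[of n s] by auto
    then show ?thesis
      using True assms(3) by (simp add: place_def)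
  next
    case False
    have L: "\<forall>l \<in> set ?L. good l" "good c" "?L \<noteq> []"
      using Cons.prems(2) set_L False by auto
    obtain l where l: "l \<in> set ?L" "nearest c ?L l"
      "capped_cost D (place c ?L) = capped_cost D ?L + min (delta c l) D"
      using capped_cost_place[OF L assms(3)] .
    obtain m where m: "m \<in> set cs" "delta c m \<le> weight n"
      using delta_le_new[of cs n s] Cons.prems(2) ns False by auto
    then have "delta c l \<le> weight n"
      using l(2) set_L unfolding nearest_def by auto
    then show ?thesis
      using l(3) by simp
  qed
  ultimately show ?case
    using Cons by simp
qed (simp add: covered_def)

end

section \<open>Greedy cutting into groups\<close>

lemma groups_concat: "concat (groups K D ps) = ps"
  by (induction ps) (auto split: list.split)

lemma groups_nonempty: "g \<in> set (groups K D ps) \<Longrightarrow> g \<noteq> []"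
  by (induction ps arbitrary: g) (auto split: list.splits if_splits)

lemma groups_cost: "g \<in> set (groups K D ps) \<Longrightarrow> 0 \<le> K \<Longrightarrow> D * cost g \<le> K"
  by (induction ps arbitrary: g) (auto split: list.splits if_splits simp del: cost.simps(2), auto)

text \<open>Turns the division-free test of \<open>groups\<close> into an integer threshold: a group
  that fails it costs at least \<open>K div D + 1\<close>.\<close>

lemma mult_le_iff_le_div: "0 < D \<Longrightarrow> D * c \<le> K \<longleftrightarrow> c \<le> K div D" for c D K :: int
proof
  assume "0 < D" "D * c \<le> K"
  then show "c \<le> K div D"
    using zdiv_mono1[of "D * c" K D] by simp
next
  assume "0 < D" "c \<le> K div D"
  then have "D * c \<le> D * (K div D)" "0 \<le> K mod D"
    by simp_all
  then show "D * c \<le> K"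
    using mult_div_mod_eq[of D K] by linarith
qed

context tree_paths
begin

lemma capped_cost_nonneg: "\<forall>p \<in> set ps. good p \<Longrightarrow> 0 \<le> D \<Longrightarrow> 0 \<le> capped_cost D ps"
  by (induction ps) (auto simp: delta_nonneg)

text \<open>Either some climb reaches the cap, and then it alone suffices, or no climb is
  truncated.\<close>

lemma capped_cost_ge:
  assumes "\<forall>p \<in> set ps. good p" "0 \<le> D"
  shows "min (cost ps) D \<le> capped_cost D ps"
  using assms(1)
proof (induction ps)
  case (Cons p ps)
  have "0 \<le> delta p (first ps)"
    using Cons.prems delta_nonneg by simp
  moreover have "0 \<le> capped_cost D ps"
    using Cons.prems assms(2) capped_cost_nonneg by simp
  moreover have "min (cost ps) D \<le> capped_cost D ps"
    using Cons by simp
  ultimately show ?case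
    using assms(2) by (cases "ps = []") (auto simp: min_def split: if_splits)
qed (use assms(2) in simp)

text \<open>Groups are built from the right, and only the leading one can still grow, so its cost is
  kept apart. A cut before a group is made because that group together with the preceding path
  \<open>p\<close> does not fit. The climbs out of \<open>p\<close> and inside the group then reach
  the cap, and for different cuts these stretches are disjoint.\<close>

lemma capped_cost_groups:
  assumes "\<forall>p \<in> set ps. good p" "0 < D" "0 \<le> K" "groups K D ps = g # G"
  shows "int (length G) * (K div D + 1) + capped_cost (K div D + 1) g \<le> capped_cost (K div D + 1) ps"
  using assms(1,4)
proof (induction ps arbitrary: g G)
  case (Cons p ps)
  let ?C = "K div D + 1"
  show ?case
  proof (cases "groups K D ps")
    case Nil
    then show ?thesis
      using Cons.prems groups_concat[of K D ps] by simp
  next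
    case (Cons g' G')
    have C: "0 \<le> ?C"
      using assms(2,3) by (simp add: pos_imp_zdiv_nonneg_iff)
    have IH: "int (length G') * ?C + capped_cost ?C g' \<le> capped_cost ?C ps"
      using Cons.IH Cons.prems(1) Cons by simp
    have "g' \<noteq> []" "ps = g' @ concat G'"
      using groups_nonempty[of g' K D ps] groups_concat[of K D ps] Cons by auto
    then have first: "ps \<noteq> []" "first ps = first g'" "capped_cost ?C (p # g') = min (delta p (first g')) ?C + capped_cost ?C g'"
      by (auto simp: first_append)
    show ?thesis
    proof (cases "D * cost (p # g') \<le> K")
      case True
      then have "g = p # g'" "G = G'"
        using Cons.prems(2) \<open>groups K D ps = g' # G'\<close> by auto
      then show ?thesis
        using IH first by simp
    next
      case False
      then have "g = [p]" "G = g' # G'"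
        using Cons.prems(2) \<open>groups K D ps = g' # G'\<close> by auto
      moreover have "K div D < cost (p # g')"
        using False mult_le_iff_le_div[OF assms(2)] by (simp only: not_le)
      then have "?C \<le> capped_cost ?C (p # g')"
        using capped_cost_ge[of "p # g'" ?C] Cons.prems(1) C \<open>ps = g' @ concat G'\<close>
        by (simp add: min_def del: cost.simps capped_cost.simps split: if_splits)
      ultimately show ?thesis
        using IH first by (simp add: algebra_simps)
    qed
  qed
qed simp

section \<open>Counting against an arbitrary solution\<close>

lemma sum_covered_le:
  assumes "finite U" "\<And>e. e \<in> U \<Longrightarrow> 0 \<le> (f e :: int)" "U \<subseteq> (\<Union>P \<in> set Ps. S P)"
    "\<And>P. P \<in> set Ps \<Longrightarrow> sum f (U \<inter> S P) \<le> k"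
  shows "sum f U \<le> int (length Ps) * k"
proof -
  have "sum f (U \<inter> (\<Union>P \<in> set Qs. S P)) \<le> int (length Qs) * k" if "set Qs \<subseteq> set Ps" for Qs
    using that
  proof (induction Qs)
    case (Cons Q Qs)
    let ?A = "U \<inter> S Q" and ?B = "U \<inter> (\<Union>P \<in> set Qs. S P)"
    have "sum f (?A \<union> ?B) + sum f (?A \<inter> ?B) = sum f ?A + sum f ?B"
      using assms(1) by (intro sum.union_inter) auto
    moreover have "0 \<le> sum f (?A \<inter> ?B)"
      using assms(2) by (intro sum_nonneg) auto
    moreover have "U \<inter> (\<Union>P \<in> set (Q # Qs). S P) = ?A \<union> ?B"
      by auto
    ultimately show ?case
      using Cons assms(4)[of Q] by (simp add: algebra_simps)
  qed simp
  from this[of Ps] assms(3) show ?thesis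
    by (simp add: Int_absorb2)
qed

text \<open>A pair \<open>(p, B)\<close> abstracts from a walk: \<open>p\<close> is the path of its
  end, and \<open>B\<close> contains the arcs off \<open>p\<close> whose edges it traverses. It pays
  for charges of at most \<open>?C\<close> on \<open>p\<close> and at most \<open>?k\<close> on
  \<open>B\<close>.\<close>

theorem length_groups:
  assumes "\<forall>c \<in> set cs. good c" "0 < D" "0 \<le> K" "cs \<noteq> [] \<Longrightarrow> Ps \<noteq> []"
    and cover: "covered cs \<subseteq> (\<Union>(p, B) \<in> set Ps. set p \<union> B)"
    and Ps: "\<And>p B. (p, B) \<in> set Ps \<Longrightarrow>
      good p \<and> finite B \<and> (\<forall>e \<in> B. 0 \<le> snd e) \<and> D * (\<Sum>e\<in>B. snd e) \<le> K"
  shows "length (groups K D (arrange cs)) \<le> 2 * length Ps"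
proof (cases "cs = []")
  case True
  then show ?thesis
    by (simp add: arrange_def)
next
  case False
  let ?k = "K div D"
  let ?C = "?k + 1" and ?U = "covered cs" and ?L = "arrange cs"
  define xs where "xs = sort_key weight cs"
  have xs: "sorted (map weight xs)" "set xs = set cs"
    by (auto simp: xs_def)
  have k: "0 \<le> ?k"
    using assms(2,3) by (simp add: pos_imp_zdiv_nonneg_iff)
  have U: "covered xs = ?U"
    using xs(2) by (simp add: covered_def)
  have good: "\<forall>c \<in> set xs. good c"
    using assms(1) xs(2) by simp
  note nonneg = covered_nonneg[OF assms(1)]
  have set_L: "set ?L = set cs"
    unfolding arrange_def xs_def[symmetric] using set_foldr_place xs(2) by simp
  have "sum (charge ?C xs) ?U \<le> int (length Ps) * (?C + ?k)"
  proof (rule sum_covered_le[OF finite_covered])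
    show "?U \<subseteq> (\<Union>P \<in> set Ps. set (fst P) \<union> snd P)"
      using cover by (auto simp: case_prod_unfold)
    show "0 \<le> charge ?C xs e" if "e \<in> ?U" for e
      using charge_bounds(1) nonneg[OF that] .
  next
    fix P
    assume P: "P \<in> set Ps"
    obtain p B where pB: "P = (p, B)"
      by (cases P)
    note PB = Ps[OF P[unfolded pB]]
    have B: "finite B" "\<And>e. e \<in> B \<Longrightarrow> 0 \<le> snd e"
      using PB by auto
    have "sum (charge ?C xs) (?U \<inter> B) \<le> sum snd (?U \<inter> B)"
      using B by (intro sum_mono charge_bounds(2)) auto
    also have "\<dots> \<le> sum snd B"
      using B by (intro sum_mono2) auto
    also have "\<dots> \<le> ?k"
      using PB assms(2) by (simp add: mult_le_iff_le_div)
    finally have "sum (charge ?C xs) (?U \<inter> B) \<le> ?k" .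
    moreover have "sum (charge ?C xs) (?U \<inter> set p) \<le> ?C"
      using charge_path[OF good, of p ?C] PB k U by simp
    moreover have "sum (charge ?C xs) ((?U \<inter> set p) \<union> (?U \<inter> B)) + sum (charge ?C xs) ((?U \<inter> set p) \<inter> (?U \<inter> B)) =
        sum (charge ?C xs) (?U \<inter> set p) + sum (charge ?C xs) (?U \<inter> B)"
      using B(1) by (intro sum.union_inter) auto
    moreover have "0 \<le> sum (charge ?C xs) ((?U \<inter> set p) \<inter> (?U \<inter> B))"
      using nonneg by (intro sum_nonneg charge_bounds(1)) auto
    moreover have "?U \<inter> (set (fst P) \<union> snd P) = (?U \<inter> set p) \<union> (?U \<inter> B)"
      unfolding pB by auto
    ultimately show "sum (charge ?C xs) (?U \<inter> (set (fst P) \<union> snd P)) \<le> ?C + ?k"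
      by simp
  qed
  moreover have "capped_cost ?C ?L \<le> sum (charge ?C xs) ?U"
    unfolding arrange_def xs_def[symmetric] U[symmetric]
    using capped_cost_le_charge[OF xs(1) good] k by simp
  ultimately have upper: "capped_cost ?C ?L \<le> int (length Ps) * (?C + ?k)"
    by linarith
  have "?L \<noteq> []"
    using set_L False by auto
  then have "groups K D ?L \<noteq> []"
    using groups_concat[of K D ?L] by auto
  then obtain g G where gG: "groups K D ?L = g # G"
    by (cases "groups K D ?L") auto
  have goodL: "\<forall>c \<in> set ?L. good c"
    using set_L assms(1) by simp
  moreover have "set g \<subseteq> set ?L"
    using arg_cong[OF groups_concat[of K D ?L], of set] gG by auto
  ultimately have "0 \<le> capped_cost ?C g"
    using k by (intro capped_cost_nonneg) auto
  then have "int (length G) * ?C \<le> int (length Ps) * (?C + ?k)"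
    using capped_cost_groups[OF goodL assms(2,3) gG] upper by linarith
  \<comment> \<open>\<open>?C + ?k\<close> is \<open>2 * ?C - 1\<close>, and as \<open>Ps\<close> is
    nonempty the missing unit makes the inequality strict. This compensates for the leading group
    \<open>g\<close>, which \<open>length G\<close> does not count.\<close>
  also have "\<dots> < int (length Ps) * (2 * ?C)"
    using assms(4)[OF False] by simp
  finally have "int (length G) * ?C < int (2 * length Ps) * ?C"
    by (simp add: algebra_simps)
  then have "length G < 2 * length Ps"
    using k by (simp add: mult_less_cancel_right)
  then show ?thesis
    using gG by simp
qed

end

section \<open>Paths from the depot\<close>

text \<open>Lets goodness survive the growth of the table, whose lookups play the part of
  \<open>rest\<close>.\<close>

lemma (in tree_paths) good_cong:
  "good p \<Longrightarrow> (\<And>e. e \<in> set p \<Longrightarrow> rest' e = rest e) \<Longrightarrow> tree_paths.good rest' p"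
proof (induction p)
  case Nil
  interpret T: tree_paths rest' .
  show ?case by simp
next
  case (Cons e p)
  interpret T: tree_paths rest' .
  show ?case
    using Cons by simp
qed

lemma good_Nil: "tree_paths.good rest []"
proof -
  interpret tree_paths rest .
  show ?thesis by simp
qed

lemma lookup_simps [simp]:
  "lookup [] v = []"
  "lookup (q # tb) v = (if fst q = v then snd q else lookup tb v)"
  by (simp_all add: lookup_def first_def)

lemma lookup_eq: "distinct (map fst tb) \<Longrightarrow> (v, p) \<in> set tb \<Longrightarrow> lookup tb v = p"
  by (induction tb) force+

section \<open>The table as a spanning tree\<close>

locale scaled_instance = school_bus_tree T len depot clients bound
  for T :: "nat pair_pre_digraph" and len depot clients bound +
  fixes vs :: "nat list" and as :: "tree_arc list" and Q :: int
  assumes set_vs: "set vs = pverts T"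
    and fst_as: "fst ` set as = parcs T"
    and len_as: "(e, l) \<in> set as \<Longrightarrow> Q * len e = l"
    and Q_pos: "0 < Q"
begin

definition path :: "nat \<Rightarrow> tree_path" where
  "path v = lookup (table vs as depot) v"

definition parent_path :: "tree_arc \<Rightarrow> tree_path" where
  "parent_path e = path (fst (fst e))"

text \<open>The invariant of the search; goodness refers to lookups in the table itself. Since both
  ends of every stored arc are known vertices, an arc to a new vertex occurs on no stored path, and
  adding its entry disturbs no lookup on which those paths depend.\<close>

definition valid_table :: "(nat \<times> tree_path) list \<Rightarrow> bool" where
  "valid_table tb \<longleftrightarrow> distinct (map fst tb) \<and> (depot, []) \<in> set tb \<and>
     (\<forall>(v, p) \<in> set tb. tree_paths.good (\<lambda>e. lookup tb (fst (fst e))) p \<and> v \<in> pverts T \<and>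
       (\<forall>e \<in> set p. e \<in> set as \<and> fst (fst e) \<in> fst ` set tb \<and> snd (fst e) \<in> fst ` set tb) \<and>
       (case p of [] \<Rightarrow> v = depot | e # _ \<Rightarrow> snd (fst e) = v))"

lemma valid_tableD:
  assumes "valid_table tb"
  shows "distinct (map fst tb)" "(depot, []) \<in> set tb"
    "(v, p) \<in> set tb \<Longrightarrow> tree_paths.good (\<lambda>e. lookup tb (fst (fst e))) p"
    "(v, p) \<in> set tb \<Longrightarrow> v \<in> pverts T"
    "(v, p) \<in> set tb \<Longrightarrow> e \<in> set p \<Longrightarrow> e \<in> set as"
    "(v, p) \<in> set tb \<Longrightarrow> case p of [] \<Rightarrow> v = depot | e # _ \<Rightarrow> snd (fst e) = v"
  using assms unfolding valid_table_def by blast+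

lemma valid_table_verts: "valid_table tb \<Longrightarrow> fst ` set tb \<subseteq> pverts T"
  using valid_tableD(4) by fastforce

lemma arcs_nonneg: "e \<in> set as \<Longrightarrow> 0 \<le> snd e"
proof -
  assume e: "e \<in> set as"
  then have "0 \<le> len (fst e)"
    using len_nonneg fst_as by blast
  moreover have "Q * len (fst e) = of_int (snd e)"
    using e len_as[of "fst e" "snd e"] by simp
  ultimately have "0 \<le> real_of_int (snd e)"
    using Q_pos by (metis mult_nonneg_nonneg of_int_0_le_iff less_imp_le)
  then show ?thesis
    by simp
qed

lemma arc_verts: "e \<in> set as \<Longrightarrow> fst (fst e) \<in> pverts T \<and> snd (fst e) \<in> pverts T"
  using fst_as arc_fst_in_verts arc_snd_in_verts by blast

lemma valid_extend:
  assumes "valid_table tb" "e \<in> set as"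
  shows "valid_table (extend e tb)"
proof (cases "fst (fst e) \<in> fst ` set tb \<and> snd (fst e) \<notin> fst ` set tb")
  case True
  define u v where "u = fst (fst e)" and "v = snd (fst e)"
  define tb' where "tb' = (v, e # lookup tb u) # tb"
  have ext: "extend e tb = tb'"
    using True by (simp add: extend_def tb'_def u_def v_def)
  interpret A: tree_paths "\<lambda>e. lookup tb (fst (fst e))" .
  interpret B: tree_paths "\<lambda>e. lookup tb' (fst (fst e))" .
  have valid: "distinct (map fst tb)" "(depot, []) \<in> set tb" and
    entry: "\<And>x p. (x, p) \<in> set tb \<Longrightarrow> A.good p \<and> x \<in> pverts T \<and>
      (\<forall>e \<in> set p. e \<in> set as \<and> fst (fst e) \<in> fst ` set tb \<and> snd (fst e) \<in> fst ` set tb) \<and>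
      (case p of [] \<Rightarrow> x = depot | e # _ \<Rightarrow> snd (fst e) = x)"
    using assms(1) unfolding valid_table_def by auto
  have v: "v \<notin> fst ` set tb"
    using True by (simp add: v_def)
  have lookup: "lookup tb' x = lookup tb x" if "x \<in> fst ` set tb" for x
    using that v by (auto simp: tb'_def)
  have good: "B.good p" if "(x, p) \<in> set tb" for x p
    by (rule A.good_cong) (use entry[OF that] lookup in auto)
  obtain p where p: "(u, p) \<in> set tb"
    using True by (auto simp: u_def)
  then have lp: "lookup tb u = p"
    using lookup_eq valid(1) by blast
  have "lookup tb' (fst (fst e)) = p"
    using lookup[of u] lp True by (simp add: u_def)
  moreover have "e \<notin> set p"
    using entry[OF p] v unfolding v_def by blast
  ultimately have "B.good (e # p)"
    using good[OF p] arcs_nonneg[OF assms(2)] by simp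
  moreover have "u \<in> fst ` set tb"
    using True by (simp add: u_def)
  ultimately have new: "B.good (e # p)" "u \<in> fst ` set tb" .
  have all: "B.good q \<and> x \<in> pverts T \<and>
      (\<forall>e \<in> set q. e \<in> set as \<and> fst (fst e) \<in> fst ` set tb' \<and> snd (fst e) \<in> fst ` set tb') \<and>
      (case q of [] \<Rightarrow> x = depot | e # _ \<Rightarrow> snd (fst e) = x)" if "(x, q) \<in> set tb'" for x q
  proof (cases "(x, q) \<in> set tb")
    case True
    then show ?thesis
      using good[OF True] entry[OF True] by (auto simp: tb'_def)
  next
    case False
    then have "x = v" "q = e # p"
      using that lp by (auto simp: tb'_def)
    then show ?thesis
      using new entry[OF p] assms(2) arc_verts[OF assms(2)] by (auto simp: tb'_def u_def v_def)
  qed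
  have "distinct (map fst tb')" "(depot, []) \<in> set tb'"
    using valid v by (auto simp: tb'_def)
  with all show ?thesis
    unfolding ext valid_table_def by blast
next
  case False
  then have "extend e tb = tb"
    by (auto simp: extend_def)
  then show ?thesis
    using assms(1) by simp
qed

lemma valid_foldr_extend:
  "set xs \<subseteq> set as \<Longrightarrow> valid_table (foldr extend xs [(depot, [])])"
proof (induction xs)
  case Nil
  show ?case
    using depot_in_verts by (simp add: valid_table_def good_Nil del: lookup_simps)
qed (simp add: valid_extend)

lemma known_extend: "fst ` set tb \<subseteq> fst ` set (foldr extend xs tb)"
  by (induction xs) (auto simp: extend_def)

lemma known_extend_arc:
  assumes "e \<in> set xs" "fst (fst e) \<in> fst ` set tb"
  shows "snd (fst e) \<in> fst ` set (foldr extend xs tb)"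
  using assms(1)
proof (induction xs)
  case (Cons x xs)
  have mono: "fst ` set tb' \<subseteq> fst ` set (extend x tb')" for tb'
    by (auto simp: extend_def)
  show ?case
  proof (cases "x = e")
    case True
    have "fst (fst e) \<in> fst ` set (foldr extend xs tb)"
      using known_extend assms(2) by blast
    moreover have "snd (fst e) \<in> fst ` set (extend e tb')" if "fst (fst e) \<in> fst ` set tb'" for tb'
      using that by (auto simp: extend_def)
    ultimately show ?thesis
      unfolding True by simp
  next
    case False
    then show ?thesis
      using Cons mono by auto
  qed
qed simp

lemma leaving_arc:
  assumes "depot \<in> K" "v \<in> pverts T" "v \<notin> K"
  obtains a b where "(a, b) \<in> parcs T" "a \<in> K" "b \<notin> K"
proof -
  have "depot \<rightarrow>\<^sup>*\<^bsub>mk_symmetric (with_proj T)\<^esub> v"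
    using connected assms(2) depot_in_verts
    unfolding connected_def strongly_connected_def by simp
  then have "depot \<rightarrow>\<^sup>*\<^bsub>with_proj T\<^esub> v"
    using reachable_mk_symmetric_eq[OF sym_arcs] by simp
  then obtain p where "awalk depot p v"
    unfolding reachable_awalk by blast
  then have "\<exists>a b. (a, b) \<in> parcs T \<and> a \<in> K \<and> b \<notin> K"
    using assms(1,3)
  proof (induction p arbitrary: depot)
    case (Cons e p)
    then show ?case
      by (cases "snd e \<in> K") (auto simp: awalk_Cons_iff, metis prod.collapse)
  qed (auto simp: awalk_Nil_iff)
  then show ?thesis
    using that by blast
qed

text \<open>Every arc leaving the set of known vertices is caught by the next pass. The strict
  inequality counts the depot, known before the first pass; after \<open>length vs\<close> passes it
  would exceed the number of vertices.\<close>

lemma known_rounds: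
  defines "R \<equiv> \<lambda>k. foldr extend (concat (replicate k as)) [(depot, [])]"
  shows "fst ` set (R k) = pverts T \<or> k < card (fst ` set (R k))"
proof (induction k)
  case 0
  then show ?case
    by (simp add: R_def)
next
  case (Suc k)
  have R: "R (Suc k) = foldr extend as (R k)"
    by (simp add: R_def)
  have sub: "fst ` set (R j) \<subseteq> pverts T" "depot \<in> fst ` set (R j)" for j
  proof -
    have "set (concat (replicate j as)) \<subseteq> set as"
      by (induction j) auto
    then have "valid_table (R j)"
      unfolding R_def by (rule valid_foldr_extend)
    then show "fst ` set (R j) \<subseteq> pverts T" "depot \<in> fst ` set (R j)"
      using valid_table_verts valid_tableD(2)[of "R j"] by force+
  qed
  have mono: "fst ` set (R k) \<subseteq> fst ` set (R (Suc k))"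
    unfolding R by (rule known_extend)
  show ?case
  proof (cases "fst ` set (R k) = pverts T")
    case True
    then show ?thesis
      using mono sub(1)[of "Suc k"] by blast
  next
    case False
    then obtain v where "v \<in> pverts T" "v \<notin> fst ` set (R k)"
      using sub(1) by blast
    then obtain a b where ab: "(a, b) \<in> parcs T" "a \<in> fst ` set (R k)" "b \<notin> fst ` set (R k)"
      using leaving_arc[OF sub(2)] by blast
    then obtain e where "e \<in> set as" "fst e = (a, b)"
      using fst_as by (metis imageE)
    then have "b \<in> fst ` set (R (Suc k))"
      using known_extend_arc[of e as "R k"] ab(2) unfolding R by simp
    then have "fst ` set (R k) \<subset> fst ` set (R (Suc k))"
      using ab(3) mono by blast
    then have "card (fst ` set (R k)) < card (fst ` set (R (Suc k)))"
      by (intro psubset_card_mono) auto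
    then show ?thesis
      using Suc False by linarith
  qed
qed

lemma table_rounds: "table vs as depot = foldr extend (concat (replicate (length vs) as)) [(depot, [])]"
  unfolding table_def by (simp add: map_replicate_const)

lemma valid_table: "valid_table (table vs as depot)"
proof -
  have "set (concat (replicate j as)) \<subseteq> set as" for j
    by (induction j) auto
  then show ?thesis
    unfolding table_rounds by (rule valid_foldr_extend)
qed

lemma known_table: "fst ` set (table vs as depot) = pverts T"
proof (rule ccontr)
  assume *: "\<not> ?thesis"
  have "fst ` set (table vs as depot) \<subseteq> pverts T"
    using valid_table by (rule valid_table_verts)
  then have "card (fst ` set (table vs as depot)) \<le> card (set vs)"
    using set_vs by (intro card_mono) auto
  also have "\<dots> \<le> length vs"
    by (rule card_length)
  finally show False
    using * known_rounds[of "length vs"] unfolding table_rounds by simp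
qed

sublocale tree_paths parent_path .

lemma path_entry: "v \<in> pverts T \<Longrightarrow> (v, path v) \<in> set (table vs as depot)"
proof -
  assume "v \<in> pverts T"
  then obtain p where "(v, p) \<in> set (table vs as depot)"
    unfolding known_table[symmetric] by auto
  moreover from this have "path v = p"
    unfolding path_def using valid_tableD(1)[OF valid_table] lookup_eq by blast
  ultimately show ?thesis
    by simp
qed

lemma path_depot [simp]: "path depot = []"
  unfolding path_def using valid_tableD(1,2)[OF valid_table] lookup_eq by blast

lemma good_path: "v \<in> pverts T \<Longrightarrow> good (path v)"
  using valid_tableD(3)[OF valid_table path_entry] unfolding path_def parent_path_def .

lemma path_arcs: "v \<in> pverts T \<Longrightarrow> set (path v) \<subseteq> set as"
  using valid_tableD(5)[OF valid_table path_entry] by blast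

lemma path_cases:
  assumes "v \<in> pverts T"
  obtains "v = depot" "path v = []"
    | u l where "path v = ((u, v), l) # path u" "((u, v), l) \<in> set as" "u \<in> pverts T"
proof (cases "path v")
  case Nil
  then show ?thesis
    using that(1) valid_tableD(6)[OF valid_table path_entry[OF assms]] by simp
next
  case (Cons e p)
  have "snd (fst e) = v"
    using Cons valid_tableD(6)[OF valid_table path_entry[OF assms]] by simp
  moreover have "p = path (fst (fst e))"
    using good_path[OF assms] unfolding Cons by (simp add: parent_path_def)
  moreover have "e \<in> set as"
    using path_arcs[OF assms] Cons by auto
  ultimately show ?thesis
    using that(2)[of "fst (fst e)" "snd e"] arc_verts[of e] Cons by auto
qed

abbreviation swaps :: "tree_path \<Rightarrow> (nat \<times> nat) list" where
  "swaps p \<equiv> map (\<lambda>e. (snd (fst e), fst (fst e))) p"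

lemma path_inj:
  assumes "path u = path v" "u \<in> pverts T" "v \<in> pverts T"
  shows "u = v"
  using assms(2)
proof (cases rule: path_cases)
  case 1
  then show ?thesis
    using assms(1,3) by (cases rule: path_cases[OF assms(3)]) auto
next
  case (2 x l)
  then show ?thesis
    using assms(1) by (cases rule: path_cases[OF assms(3)]) auto
qed

lemma path_suffix:
  assumes "v \<in> pverts T" "path v = n @ c"
  obtains z where "z \<in> pverts T" "c = path z" "awalk z (rev (map fst n)) v" "awalk v (swaps n) z"
proof -
  have "\<exists>z \<in> pverts T. c = path z \<and> awalk z (rev (map fst n)) v \<and> awalk v (swaps n) z"
    using assms
  proof (induction n arbitrary: v)
    case Nil
    then show ?case
      by (intro bexI[of _ v]) (auto simp: awalk_Nil_iff)
  next
    case (Cons e n)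
    from Cons.prems(1) show ?case
    proof (cases rule: path_cases)
      case 1
      then show ?thesis
        using Cons.prems(2) by simp
    next
      case (2 u l)
      then have e: "e = ((u, v), l)" and "path u = n @ c"
        using Cons.prems(2) by auto
      then obtain z where z: "z \<in> pverts T" "c = path z" "awalk z (rev (map fst n)) u" "awalk u (swaps n) z"
        using Cons.IH 2(3) by blast
      have uv: "(u, v) \<in> parcs T"
        using 2(2) fst_as by force
      then have "(v, u) \<in> parcs T"
        using arcs_symmetric by blast
      then have "awalk v (swaps (e # n)) z"
        using z(4) by (simp add: e awalk_Cons_iff)
      moreover have "awalk u [(u, v)] v"
        using arc_implies_awalk[of "(u, v)"] uv by simp
      then have "awalk z (rev (map fst (e # n))) v"
        using awalk_appendI[OF z(3)] by (simp add: e)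
      ultimately show ?thesis
        using z by blast
    qed
  qed
  then show ?thesis
    using that by blast
qed

lemma
  assumes "v \<in> pverts T"
  shows awalk_path: "awalk depot (rev (map fst (path v))) v"
    and awalk_path_rev: "awalk v (swaps (path v)) depot"
proof -
  obtain z where z: "z \<in> pverts T" "[] = path z" "awalk z (rev (map fst (path v))) v"
      "awalk v (swaps (path v)) z"
    using path_suffix[OF assms, of "path v" "[]"] by auto
  moreover have "z = depot"
    using path_inj[OF _ z(1) depot_in_verts] z(2) by simp
  ultimately show "awalk depot (rev (map fst (path v))) v" "awalk v (swaps (path v)) depot"
    by simp_all
qed

lemma path_arc_tree:
  assumes "v \<in> pverts T" "((a, b), l) \<in> set (path v)"
  shows "path b = ((a, b), l) # path a"
proof -
  obtain n c where n: "path v = n @ ((a, b), l) # c"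
    using assms(2) by (meson split_list)
  then obtain z where z: "z \<in> pverts T" "((a, b), l) # c = path z"
    using path_suffix[OF assms(1)] by metis
  then show ?thesis
    using path_cases[OF z(1)] by (metis Pair_inject list.distinct(1) list.inject)
qed

text \<open>Acyclicity enters here, and only here. If neither table path used the edge, the way from
  \<open>b\<close> up to the depot and down to \<open>a\<close> would avoid the arc
  \<open>(b, a)\<close>. A simple path inside it would then have at least two arcs, and
  \<open>(a, b)\<close> would close it to a cycle of at least three.\<close>

lemma tree_arc:
  assumes "(a, b) \<in> parcs T"
  obtains l where "path b = ((a, b), l) # path a" | l where "path a = ((b, a), l) # path b"
proof (rule ccontr)
  assume not: "\<not> thesis"
  have ab: "a \<in> pverts T" "b \<in> pverts T" "a \<noteq> b"
    using assms arc_fst_in_verts arc_snd_in_verts pair_no_loops by fastforce+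
  let ?w = "swaps (path b) @ rev (map fst (path a))"
  have w: "awalk b ?w a"
    using awalk_path_rev[OF ab(2)] awalk_path[OF ab(1)] by (rule awalk_appendI)
  have notin: "(b, a) \<notin> set ?w"
  proof
    assume "(b, a) \<in> set ?w"
    then consider l where "((a, b), l) \<in> set (path b)" | l where "((b, a), l) \<in> set (path a)"
      by auto
    then show False
    proof cases
      case 1
      then show ?thesis
        using path_arc_tree[OF ab(2)] that(1) not by blast
    next
      case 2
      then show ?thesis
        using path_arc_tree[OF ab(1)] that(2) not by blast
    qed
  qed
  define q where "q = awalk_to_apath ?w"
  have q: "apath b q a" "set q \<subseteq> set ?w"
    unfolding q_def using apath_awalk_to_apath[OF w] awalk_to_apath_subset[OF w] by auto
  have "2 \<le> length q"
  proof (rule ccontr)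
    assume "\<not> 2 \<le> length q"
    then consider "q = []" | e where "q = [e]"
      by (cases q; cases "tl q") auto
    then show False
    proof cases
      case 1
      then show ?thesis
        using q(1) ab(3) by (simp add: apath_Nil_iff)
    next
      case (2 e)
      then have "e = (b, a)"
        using q(1) by (cases e) (auto simp: apath_def awalk_Cons_iff awalk_Nil_iff)
      then show ?thesis
        using 2 q(2) notin by auto
    qed
  qed
  moreover have "awalk a ((a, b) # q) a" "distinct (awalk_verts b q)"
    using q(1) assms by (auto simp: apath_def awalk_Cons_iff)
  then have "cycle ((a, b) # q)"
    unfolding cycle_def by (intro exI[of _ a]) auto
  ultimately show False
    using acyclic by (metis Suc_le_mono length_Cons numeral_2_eq_2 numeral_3_eq_3)
qed

end

section \<open>Walks in the tree\<close>

context scaled_instance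
begin

text \<open>
  The tree arcs whose underlying edge is traversed by a walk. Such an edge off the path to the
  end of the walk is traversed at least twice.
\<close>

definition touched :: "(nat \<times> nat) list \<Rightarrow> tree_arc set" where
  "touched p = {e \<in> set as. path (snd (fst e)) = e # path (fst (fst e)) \<and>
     (fst e \<in> set p \<or> prod.swap (fst e) \<in> set p)}"

lemma finite_touched: "finite (touched p)"
  unfolding touched_def by simp

lemma touched_nonneg: "e \<in> touched p \<Longrightarrow> 0 \<le> snd e"
  unfolding touched_def using arcs_nonneg by blast

lemma len_arc: "e \<in> set as \<Longrightarrow> Q * len (fst e) = of_int (snd e)"
  using len_as[of "fst e" "snd e"] by simp

lemma len_arc_swap: "e \<in> set as \<Longrightarrow> Q * len (snd (fst e), fst (fst e)) = of_int (snd e)"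
proof -
  assume e: "e \<in> set as"
  then have "fst e \<in> parcs T"
    unfolding fst_as[symmetric] by (rule imageI)
  then have "len (fst e) = len (snd (fst e), fst (fst e))"
    using len_sym[of "fst (fst e)" "snd (fst e)"] by simp
  then show ?thesis
    using len_arc[OF e] by simp
qed

text \<open>An edge cannot be a tree arc in both directions, because each direction would make one
  endpoint's path longer by one than the other's. So the new step touches just one tree arc.\<close>

lemma touched_snoc:
  assumes "b \<in> pverts T" "e \<in> set as" "path (snd (fst e)) = e # path (fst (fst e))"
    "a = fst e \<or> a = prod.swap (fst e)"
  shows "touched (p @ [a]) = insert e (touched p)"
proof -
  have "e' = e" if e': "path (snd (fst e')) = e' # path (fst (fst e'))"
    "fst e' = a \<or> prod.swap (fst e') = a" for e'
  proof (cases "fst e' = fst e")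
    case True
    then show ?thesis
      using e'(1) assms(3) by (metis list.inject)
  next
    case False
    then have "fst e' = prod.swap (fst e)"
      using e'(2) assms(4) by (auto simp: prod_eq_iff)
    then have "length (path (snd (fst e'))) = length (path (fst (fst e)))"
      "length (path (fst (fst e'))) = length (path (snd (fst e)))"
      by simp_all
    moreover have "length (path (snd (fst e'))) = length (path (fst (fst e'))) + 1"
      "length (path (snd (fst e))) = length (path (fst (fst e))) + 1"
      using arg_cong[OF e'(1), of length] arg_cong[OF assms(3), of length] by simp_all
    ultimately show ?thesis
      by linarith
  qed
  moreover have "e \<in> touched (p @ [a])"
    using assms(2-4) unfolding touched_def by auto
  ultimately show ?thesis
    unfolding touched_def by auto
qed

text \<open>The walk is extended at its end. A step down lengthens the path of the end by its arc. A
  step up moves its arc off that path: the weight drops by \<open>l\<close>, the doubled sum grows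
  by at most \<open>2 * l\<close>, and the step pays the difference. The first claim ensures that
  the arc of an upward step was touched before.\<close>

lemma walk_bound:
  assumes "awalk depot p v"
  shows "set (path v) \<subseteq> touched p"
    and "of_int (weight (path v) + 2 * (\<Sum>e \<in> touched p - set (path v). snd e)) \<le> Q * awalk_cost len p"
proof -
  have "set (path v) \<subseteq> touched p \<and>
    of_int (weight (path v) + 2 * (\<Sum>e \<in> touched p - set (path v). snd e)) \<le> Q * awalk_cost len p"
    using assms
  proof (induction p arbitrary: v rule: rev_induct)
    case Nil
    then have v: "v = depot"
      by (simp add: awalk_Nil_iff)
    show ?case
      unfolding v by (simp add: touched_def)
  next
    case (snoc arc p)
    obtain a b where arc: "arc = (a, b)"
      by (cases arc)
    have p: "awalk depot p a" and ab: "(a, b) \<in> parcs T" and "v = b"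
      using snoc.prems by (auto simp: arc awalk_Cons_iff awalk_Nil_iff)
    have verts: "a \<in> pverts T" "b \<in> pverts T"
      using arc_fst_in_verts[OF ab] arc_snd_in_verts[OF ab] by simp_all
    let ?S = "\<lambda>p v. \<Sum>e \<in> touched p - set (path v). snd e"
    have IH: "set (path a) \<subseteq> touched p" "of_int (weight (path a) + 2 * ?S p a) \<le> Q * awalk_cost len p"
      using snoc.IH[OF p] by auto
    from ab show ?case
    proof (cases rule: tree_arc)
      case (1 l)
      let ?e = "((a, b), l)"
      have e: "?e \<in> set as"
        using path_arcs[OF verts(2)] 1 by auto
      have t: "touched (p @ [arc]) = insert ?e (touched p)"
        using touched_snoc[OF verts(2) e] 1 by (simp add: arc)
      have "?S (p @ [arc]) b \<le> ?S p a"
        unfolding t 1 by (intro sum_mono2) (auto simp: finite_touched dest: touched_nonneg)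
      then have "weight (path b) + 2 * ?S (p @ [arc]) b \<le> weight (path a) + 2 * ?S p a + l"
        using 1 by simp
      then have "real_of_int (weight (path b) + 2 * ?S (p @ [arc]) b) \<le> of_int (weight (path a) + 2 * ?S p a + l)"
        by (simp only: of_int_le_iff)
      moreover have "Q * awalk_cost len (p @ [arc]) = Q * awalk_cost len p + l"
        using len_arc[OF e] by (simp add: arc distrib_left)
      ultimately show ?thesis
        using IH t 1 unfolding \<open>v = b\<close> by (simp only: of_int_add) auto
    next
      case (2 l)
      let ?e = "((b, a), l)"
      have e: "?e \<in> set as"
        using path_arcs[OF verts(1)] 2 by auto
      have "touched (p @ [arc]) = insert ?e (touched p)"
        using touched_snoc[OF verts(2) e] 2 by (simp add: arc)
      then have t: "touched (p @ [arc]) = touched p"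
        using IH(1) 2 by auto
      have "?S (p @ [arc]) b \<le> sum snd (insert ?e (touched p - set (path a)))"
        unfolding t 2 by (intro sum_mono2) (use arcs_nonneg[OF e] in \<open>auto simp: finite_touched dest: touched_nonneg\<close>)
      also have "\<dots> = l + ?S p a"
        using 2 by (subst sum.insert) (auto simp: finite_touched)
      finally have "?S (p @ [arc]) b \<le> l + ?S p a" .
      then have "weight (path b) + 2 * ?S (p @ [arc]) b \<le> weight (path a) + 2 * ?S p a + l"
        using 2 by simp
      then have "real_of_int (weight (path b) + 2 * ?S (p @ [arc]) b) \<le> of_int (weight (path a) + 2 * ?S p a + l)"
        by (simp only: of_int_le_iff)
      moreover have "Q * awalk_cost len (p @ [arc]) = Q * awalk_cost len p + l"
        using len_arc_swap[OF e] by (simp add: arc distrib_left)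
      ultimately show ?thesis
        using IH t 2 unfolding \<open>v = b\<close> by (simp only: of_int_add) auto
    qed
  qed
  then show "set (path v) \<subseteq> touched p"
    "of_int (weight (path v) + 2 * (\<Sum>e \<in> touched p - set (path v). snd e)) \<le> Q * awalk_cost len p"
    by auto
qed

lemma visited_touched:
  assumes "awalk depot p v" "c \<in> set (awalk_verts depot p)"
  shows "set (path c) \<subseteq> touched p"
proof -
  obtain q r where "p = q @ r" "awalk depot q c"
    using awalk_decomp[OF assms] by blast
  moreover have "touched q \<subseteq> touched (q @ r)"
    unfolding touched_def by auto
  ultimately show ?thesis
    using walk_bound(1) by blast
qed

section \<open>Distances and regrets in terms of tree paths\<close>

lemma cost_arcs:
  assumes "set n \<subseteq> set as"
  shows "Q * awalk_cost len (rev (map fst n)) = weight n" "Q * awalk_cost len (swaps n) = weight n"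
proof -
  show "Q * awalk_cost len (swaps n) = weight n"
    using assms by (induction n) (auto simp: distrib_left len_arc_swap)
  show "Q * awalk_cost len (rev (map fst n)) = weight n"
    using assms by (induction n) (auto simp: distrib_left len_arc)
qed

lemma dist_depot:
  assumes "v \<in> pverts T"
  shows "\<mu> len depot v = ereal (weight (path v) / Q)"
proof (rule antisym)
  have "awalk_cost len (rev (map fst (path v))) = weight (path v) / Q"
    using cost_arcs(1)[OF path_arcs[OF assms]] Q_pos by (simp add: field_simps)
  then show "\<mu> len depot v \<le> ereal (weight (path v) / Q)"
    using min_cost_le_walk_cost[OF awalk_path[OF assms], of len] by simp
  have "weight (path v) / Q \<le> awalk_cost len p" if "awalk depot p v" for p
  proof -
    have "0 \<le> (\<Sum>e \<in> touched p - set (path v). snd e)"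
      by (intro sum_nonneg) (auto dest: touched_nonneg)
    then have "of_int (weight (path v)) \<le> real_of_int (weight (path v) + 2 * (\<Sum>e \<in> touched p - set (path v). snd e))"
      by (simp only: of_int_le_iff)
    then have "of_int (weight (path v)) \<le> Q * awalk_cost len p"
      using walk_bound(2)[OF that] by linarith
    then show ?thesis
      using Q_pos by (simp add: divide_le_eq mult.commute)
  qed
  then show "ereal (weight (path v) / Q) \<le> \<mu> len depot v"
    unfolding \<mu>_def by (auto intro: INF_greatest)
qed

lemma regret_le_iff:
  assumes "v \<in> pverts T"
  shows "regret depot p v \<le> ereal bound \<longleftrightarrow> Q * awalk_cost len p - weight (path v) \<le> Q * bound"
proof -
  have "awalk_cost len p - weight (path v) / Q \<le> bound \<longleftrightarrow>
      Q * (awalk_cost len p - weight (path v) / Q) \<le> Q * bound"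
    using Q_pos by (intro mult_le_cancel_left_pos[symmetric]) simp
  also have "Q * (awalk_cost len p - weight (path v) / Q) = Q * awalk_cost len p - weight (path v)"
    using Q_pos by (simp add: field_simps)
  finally show ?thesis
    unfolding regret_def dist_depot[OF assms] by simp
qed

lemma awalk_segment:
  fixes u v
  defines "p \<equiv> path_diff (path u) (path v)" and "q \<equiv> path_diff (path v) (path u)"
  assumes "u \<in> pverts T" "v \<in> pverts T"
  shows "awalk u (swaps p @ rev (map fst q)) v"
    and "Q * awalk_cost len (swaps p @ rev (map fst q)) = weight p + weight q"
proof -
  obtain c where c: "path u = p @ c" "path v = q @ c"
    unfolding p_def q_def using path_diff_decomp[OF good_path good_path] assms(3,4) by metis
  obtain z where z: "z \<in> pverts T" "c = path z" "awalk u (swaps p) z"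
    using path_suffix[OF assms(3) c(1)] by metis
  obtain z' where z': "z' \<in> pverts T" "c = path z'" "awalk z' (rev (map fst q)) v"
    using path_suffix[OF assms(4) c(2)] by metis
  have "z' = z"
    using path_inj z z' by metis
  then show "awalk u (swaps p @ rev (map fst q)) v"
    using z(3) z'(3) by (auto intro: awalk_appendI)
  have "set p \<subseteq> set as" "set q \<subseteq> set as"
    using path_arcs[OF assms(3)] path_arcs[OF assms(4)] unfolding p_def q_def path_diff_def by auto
  then show "Q * awalk_cost len (swaps p @ rev (map fst q)) = weight p + weight q"
    by (simp add: distrib_left cost_arcs)
qed

lemma awalk_walk:
  assumes "cs \<noteq> []" "set cs \<subseteq> pverts T"
  shows "awalk (hd cs) (walk (map path cs)) (last cs)"
    "set cs \<subseteq> set (awalk_verts (hd cs) (walk (map path cs)))"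
    "Q * awalk_cost len (walk (map path cs)) =
       2 * cost (map path cs) + weight (path (last cs)) - weight (path (hd cs))"
proof -
  have "awalk (hd cs) (walk (map path cs)) (last cs) \<and>
    set cs \<subseteq> set (awalk_verts (hd cs) (walk (map path cs))) \<and>
    Q * awalk_cost len (walk (map path cs)) =
       2 * cost (map path cs) + weight (path (last cs)) - weight (path (hd cs))"
    using assms
  proof (induction cs rule: list_nonempty_induct)
    case (single c)
    then show ?case
      by (simp add: awalk_Nil_iff)
  next
    case (cons c cs)
    obtain d ds where cs: "cs = d # ds"
      using cons.hyps by (cases cs) auto
    let ?s = "swaps (path_diff (path c) (path d)) @ rev (map fst (path_diff (path d) (path c)))"
    let ?w = "walk (map path cs)"
    have V: "c \<in> pverts T" "d \<in> pverts T"
      using cons.prems cs by auto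
    have walk: "walk (map path (c # cs)) = ?s @ ?w"
      by (simp add: cs)
    have IH: "awalk d ?w (last cs)" "set cs \<subseteq> set (awalk_verts d ?w)"
      "Q * awalk_cost len ?w = 2 * cost (map path cs) + weight (path (last cs)) - weight (path d)"
      using cons by (auto simp: cs)
    note s = awalk_segment[OF V]
    have "awalk c (?s @ ?w) (last cs)"
      using s(1) IH(1) by (rule awalk_appendI)
    moreover have "set (awalk_verts c (?s @ ?w)) = set (awalk_verts c ?s) \<union> set (awalk_verts d ?w)"
      using s(1) IH(1) by (rule set_awalk_verts_append)
    moreover have "c \<in> set (awalk_verts c ?s)"
      using hd_in_awalk_verts(1)[OF s(1)] .
    \<comment> \<open>By symmetry of \<open>meet\<close>, climb and descent of a segment differ by
      the difference of the two depths. Descents can thus be replaced by climbs, and the depths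
      telescope.\<close>
    moreover have "weight (path c) - delta (path c) (path d) = weight (path d) - delta (path d) (path c)"
      using meet_sym[OF good_path good_path] V unfolding meet_def by simp
    moreover have "Q * awalk_cost len (?s @ ?w) = Q * awalk_cost len ?s + Q * awalk_cost len ?w"
      by (simp only: awalk_cost_append distrib_left)
    moreover have "cost (map path (c # cs)) = delta (path c) (path d) + cost (map path cs)"
      by (simp add: cs)
    ultimately show ?case
      using IH(2,3) s(2) cons.hyps unfolding walk delta_def by auto
  qed
  then show "awalk (hd cs) (walk (map path cs)) (last cs)"
    "set cs \<subseteq> set (awalk_verts (hd cs) (walk (map path cs)))"
    "Q * awalk_cost len (walk (map path cs)) =
       2 * cost (map path cs) + weight (path (last cs)) - weight (path (hd cs))"
    by auto
qed

lemma tour_props: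
  assumes "cs \<noteq> []" "set cs \<subseteq> pverts T"
  shows "awalk depot (tour (map path cs)) (last cs)"
    "set cs \<subseteq> set (awalk_verts depot (tour (map path cs)))"
    "Q * awalk_cost len (tour (map path cs)) = 2 * cost (map path cs) + weight (path (last cs))"
proof -
  let ?r = "rev (map fst (path (hd cs)))"
  have tour: "tour (map path cs) = ?r @ walk (map path cs)"
    using assms(1) by (cases cs) (auto simp: tour_def)
  have hd: "hd cs \<in> pverts T"
    using assms by (cases cs) auto
  note r = awalk_path[OF hd] and w = awalk_walk[OF assms]
  show "awalk depot (tour (map path cs)) (last cs)"
    unfolding tour using r w(1) by (rule awalk_appendI)
  show "set cs \<subseteq> set (awalk_verts depot (tour (map path cs)))"
    unfolding tour set_awalk_verts_append[OF r w(1)] using w(2) by blast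
  show "Q * awalk_cost len (tour (map path cs)) = 2 * cost (map path cs) + weight (path (last cs))"
    unfolding tour using cost_arcs(1)[OF path_arcs[OF hd]] w(3) by (simp add: distrib_left)
qed

section \<open>Feasibility and quality of the output\<close>

context
  fixes cs :: "nat list" and num den :: int
  assumes set_cs: "set cs = clients" and den: "0 < den" and bound: "bound = num / den"
begin

definition solution :: "(nat \<times> nat) list list" where
  "solution = map tour (groups (num * Q) (2 * den) (arrange (map path cs)))"

lemma num_nonneg: "0 \<le> num"
  using bound_nonneg den unfolding bound by (simp add: zero_le_divide_iff)

lemma scaled_bound: "of_int (2 * x) \<le> Q * bound \<longleftrightarrow> 2 * den * x \<le> num * Q" for x
proof -
  have "of_int (2 * x) \<le> Q * bound \<longleftrightarrow> real_of_int (2 * den * x) \<le> of_int (num * Q)"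
    using den unfolding bound by (simp add: field_simps)
  then show ?thesis
    by (simp only: of_int_le_iff)
qed

lemma clients_group:
  assumes "g \<in> set (groups (num * Q) (2 * den) (arrange (map path cs)))"
  obtains xs where "g = map path xs" "xs \<noteq> []" "set xs \<subseteq> pverts T"
proof -
  have "set (arrange (map path cs)) = path ` set cs"
    unfolding arrange_def by (simp add: set_foldr_place)
  moreover have "set g \<subseteq> set (arrange (map path cs))"
    using assms arg_cong[OF groups_concat[of "num * Q" "2 * den" "arrange (map path cs)"], of set]
    by auto
  ultimately have "g \<in> lists (path ` set cs)"
    by auto
  then obtain xs where "g = map path xs" "set xs \<subseteq> set cs"
    unfolding lists_image by auto
  then show ?thesis
    using that groups_nonempty[OF assms] set_cs clients_in_verts by auto
qed

lemma solution_feasible: "feasible solution"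
  unfolding feasible_def
proof (intro conjI ballI)
  fix p
  assume "p \<in> set solution"
  then obtain g where g: "g \<in> set (groups (num * Q) (2 * den) (arrange (map path cs)))" "p = tour g"
    unfolding solution_def by auto
  obtain xs where xs: "g = map path xs" "xs \<noteq> []" "set xs \<subseteq> pverts T"
    using clients_group[OF g(1)] .
  have "last xs \<in> pverts T"
    using xs(2,3) by auto
  moreover have "2 * den * cost (map path xs) \<le> num * Q"
    using groups_cost[OF g(1)] num_nonneg Q_pos xs(1) by simp
  then have "of_int (2 * cost (map path xs)) \<le> Q * bound"
    unfolding scaled_bound .
  ultimately have "regret depot p (last xs) \<le> ereal bound"
    using tour_props(3)[OF xs(2,3)] unfolding g(2) xs(1) by (simp add: regret_le_iff)
  then show "\<exists>v. awalk depot p v \<and> regret depot p v \<le> ereal bound"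
    using tour_props(1)[OF xs(2,3)] unfolding g(2) xs(1) by blast
next
  fix c
  assume c: "c \<in> clients"
  have "path c \<in> set (arrange (map path cs))"
    using c set_cs unfolding arrange_def by (simp add: set_foldr_place)
  then obtain g where g: "g \<in> set (groups (num * Q) (2 * den) (arrange (map path cs)))" "path c \<in> set g"
    using arg_cong[OF groups_concat[of "num * Q" "2 * den" "arrange (map path cs)"], of set] by auto
  obtain xs where xs: "g = map path xs" "xs \<noteq> []" "set xs \<subseteq> pverts T"
    using clients_group[OF g(1)] .
  then have "c \<in> set xs"
    using g(2) path_inj c clients_in_verts by auto
  then have "c \<in> set (awalk_verts depot (tour g))"
    using tour_props(2)[OF xs(2,3)] unfolding xs(1) by blast
  then show "\<exists>p \<in> set solution. c \<in> set (awalk_verts depot p)"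
    using g(1) unfolding solution_def by auto
qed

lemma solution_ratio:
  assumes "feasible ps"
  shows "length solution \<le> 2 * length ps"
proof -
  \<comment> \<open>Feasibility only asserts that some end vertex exists; it is fixed here so that
    the touched arcs can be split into those on its path and those off it.\<close>
  define dest where "dest p = (SOME v. awalk depot p v \<and> regret depot p v \<le> ereal bound)" for p
  define off where "off p = touched p - set (path (dest p))" for p
  let ?Ps = "map (\<lambda>p. (path (dest p), off p)) ps"
  have walks: "awalk depot p (dest p)" "dest p \<in> pverts T" "regret depot p (dest p) \<le> ereal bound"
    if p: "p \<in> set ps" for p
  proof -
    have "\<exists>v. awalk depot p v \<and> regret depot p v \<le> ereal bound"
      using assms p unfolding feasible_def by blast
    from someI_ex[OF this]
    show "awalk depot p (dest p)" "dest p \<in> pverts T" "regret depot p (dest p) \<le> ereal bound"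
      using awalk_last_in_verts unfolding dest_def by auto
  qed
  have "length (groups (num * Q) (2 * den) (arrange (map path cs))) \<le> 2 * length ?Ps"
  proof (rule length_groups)
    show "\<forall>c \<in> set (map path cs). good c"
      using good_path set_cs clients_in_verts by auto
    show "0 < 2 * den" "0 \<le> num * Q"
      using den num_nonneg Q_pos by auto
    show "?Ps \<noteq> []" if "map path cs \<noteq> []"
      using assms set_cs that unfolding feasible_def by (cases cs) auto
    show "covered (map path cs) \<subseteq> (\<Union>(p, B) \<in> set ?Ps. set p \<union> B)"
    proof
      fix e
      assume "e \<in> covered (map path cs)"
      then obtain c where c: "c \<in> clients" "e \<in> set (path c)"
        using set_cs unfolding covered_def by auto
      then obtain p where p: "p \<in> set ps" "c \<in> set (awalk_verts depot p)"
        using assms unfolding feasible_def by blast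
      then have "e \<in> touched p"
        using visited_touched walks(1) c(2) by blast
      then show "e \<in> (\<Union>(p, B) \<in> set ?Ps. set p \<union> B)"
        using p(1) unfolding off_def by auto
    qed
  next
    fix q B
    assume "(q, B) \<in> set ?Ps"
    then obtain p where p: "p \<in> set ps" "q = path (dest p)" "B = off p"
      by auto
    have "of_int (weight q + 2 * sum snd B) \<le> Q * awalk_cost len p"
      using walk_bound(2)[OF walks(1)[OF p(1)]] unfolding p(2,3) off_def .
    moreover have "Q * awalk_cost len p - weight q \<le> Q * bound"
      using walks(2,3)[OF p(1)] unfolding p(2) by (simp only: regret_le_iff)
    ultimately have "of_int (2 * sum snd B) \<le> Q * bound"
      by (simp only: of_int_add)
    then show "good q \<and> finite B \<and> (\<forall>e \<in> B. 0 \<le> snd e) \<and> 2 * den * sum snd B \<le> num * Q"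
      unfolding scaled_bound using good_path walks(2)[OF p(1)] finite_touched touched_nonneg
      unfolding p(2,3) off_def by blast
  qed
  then show ?thesis
    unfolding solution_def by simp
qed

text \<open>The computed solution itself shows that the minimum ranges over a nonempty set and is
  therefore attained.\<close>

lemma solution_opt: "length solution \<le> 2 * opt"
proof -
  have "{length ps | ps. feasible ps} \<noteq> {}"
    using solution_feasible by blast
  then have "opt \<in> {length ps | ps. feasible ps}"
    unfolding opt_def by (rule Inf_nat_def1)
  then show ?thesis
    using solution_ratio by auto
qed

end

end

section \<open>Encoded instances\<close>

text \<open>As no arc is listed twice, exactly one factor of the product is replaced by 1, namely
  the denominator of \<open>e\<close> itself.\<close>

lemma prod_list_others:
  assumes "distinct (map fst as)" "e \<in> set as"
  shows "snd (snd e) * (\<Prod>e'\<leftarrow>as. if fst e' = fst e then 1 else snd (snd e')) = denom as"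
  using assms
proof (induction as)
  case (Cons a as)
  show ?case
  proof (cases "a = e")
    case True
    then have "(\<Prod>e'\<leftarrow>as. if fst e' = fst e then 1 else snd (snd e')) = (\<Prod>e'\<leftarrow>as. snd (snd e'))"
      using Cons.prems(1) by (intro arg_cong[of _ _ prod_list] map_cong) (auto simp: image_iff)
    then show ?thesis
      using True by (simp add: denom_def)
  next
    case False
    then have "e \<in> set as" "fst a \<noteq> fst e"
      using Cons.prems by auto
    then show ?thesis
      using Cons by (simp add: denom_def mult.left_commute)
  qed
qed simp

definition rat_arcs :: "((nat \<times> nat) \<times> rat) list \<Rightarrow> ((nat \<times> nat) \<times> int \<times> int) list" where
  "rat_arcs = map (\<lambda>(e, l). (e, quotient_of l))"

lemma rat_of_quotient: "l = of_int (fst (quotient_of l)) / of_int (snd (quotient_of l))"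
  using quotient_of_div[of l] by (cases "quotient_of l") simp

lemma real_of_quotient:
  "real_of_rat l = of_int (fst (quotient_of l)) / of_int (snd (quotient_of l))"
  by (subst rat_of_quotient) (simp add: of_rat_divide)

lemma scaled_instance_rat_arcs:
  assumes "school_bus_tree T len depot clients bound"
    and vs: "set vs = pverts T"
    and as: "distinct (map fst as)" "set (map fst as) = parcs T" "\<forall>(e, l) \<in> set as. len e = real_of_rat l"
  shows "scaled_instance T len depot clients bound vs (scaled (rat_arcs as)) (denom (rat_arcs as))"
proof -
  have fst: "map fst (rat_arcs as) = map fst as"
    by (simp add: rat_arcs_def case_prod_unfold)
  have den: "0 < snd (snd e)" if "e \<in> set (rat_arcs as)" for e
    using that quotient_of_denom_pos' by (auto simp: rat_arcs_def)
  have "0 < denom es" if "\<forall>e \<in> set es. 0 < snd (snd e)" for es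
    using that by (induction es) (auto simp: denom_def)
  then have pos: "0 < denom (rat_arcs as)"
    using den by blast
  have len: "denom (rat_arcs as) * len e = of_int l" if el: "(e, l) \<in> set (scaled (rat_arcs as))" for e l
  proof -
    obtain x where x: "x \<in> set (rat_arcs as)" "e = fst x"
      "l = fst (snd x) * (\<Prod>e'\<leftarrow>rat_arcs as. if fst e' = fst x then 1 else snd (snd e'))"
      using el unfolding scaled_def by auto
    define m where "m = (\<Prod>e'\<leftarrow>rat_arcs as. if fst e' = fst x then 1 else snd (snd e'))"
    have m: "denom (rat_arcs as) = snd (snd x) * m"
      unfolding m_def using prod_list_others[of "rat_arcs as" x] x(1) as(1) by (simp only: fst)
    obtain q where "(e, q) \<in> set as" "snd x = quotient_of q"
      using x(1,2) by (auto simp: rat_arcs_def)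
    then have "len e = of_int (fst (snd x)) / of_int (snd (snd x))"
      using as(3) real_of_quotient by auto
    moreover have "l = fst (snd x) * m"
      using x(3) unfolding m_def .
    ultimately show ?thesis
      using den[OF x(1)] unfolding m by simp
  qed
  interpret school_bus_tree T len depot clients bound
    by (rule assms(1))
  show ?thesis
  proof unfold_locales
    show "fst ` set (scaled (rat_arcs as)) = parcs T"
      using as(2) fst unfolding scaled_def by (metis (no_types, lifting) list.set_map map_map comp_def fst_conv map_eq_conv)
  qed (use vs pos len in auto)
qed

lemma enc_rat: "enc_rat q = enc_pair VInt VInt (quotient_of q)"
  by (simp add: enc_rat_def enc_pair_def)

lemma enc_rat_arcs: "enc_list (enc_pair enc_arc enc_rat) as = enc_rat_arcs (rat_arcs as)"
  by (induction as) (auto simp: rat_arcs_def enc_rat enc_pair_def)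

theorem theorem8:
  shows "\<exists>P :: prog.
    polytime_on P {x. \<exists>T len depot clients bound.
      school_bus_tree T len depot clients bound \<and>
      encodes_instance T len depot clients bound x} \<and>
    (\<forall>T len depot clients bound x.
      school_bus_tree T len depot clients bound \<and>
      encodes_instance T len depot clients bound x \<longrightarrow>
      (\<exists>ps. computes P x (enc_solution ps) \<and>
        school_bus_tree.feasible T len depot clients bound ps \<and>
        length ps \<le> 2 * school_bus_tree.opt T len depot clients bound))"
proof -
  obtain P and q :: "nat poly" where P:
    "\<And>x. \<exists>t. runs_in P (enc_input x) (enc_list (enc_list enc_arc) (routes x)) t \<and> t \<le> poly q (vsize (enc_input x))"
    using ptime_program[OF ptime_routes] by blast
  \<comment> \<open>The listings may come in any order, so an instance has many encodings. Each of
    them is literally the encoding of an input tuple, and the time bound for \<open>routes\<close>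
    covers all tuples.\<close>
  have solved: "\<exists>i. x = enc_input i \<and> school_bus_tree.feasible T len depot clients bound (routes i) \<and>
      length (routes i) \<le> 2 * school_bus_tree.opt T len depot clients bound"
    if inst: "school_bus_tree T len depot clients bound" "encodes_instance T len depot clients bound x"
    for T len depot clients bound x
  proof -
    obtain vs as cs b where
      vs: "set vs = pverts T" and
      as: "distinct (map fst as)" "set (map fst as) = parcs T" "\<forall>(e, l) \<in> set as. len e = real_of_rat l" and
      cs: "set cs = clients" and b: "bound = real_of_rat b" and
      x: "x = VPair (enc_list enc_nat vs) (VPair (enc_list (enc_pair enc_arc enc_rat) as)
               (VPair (enc_nat depot) (VPair (enc_list enc_nat cs) (enc_rat b))))"
      using inst(2) unfolding encodes_instance_def by blast
    let ?i = "(vs, rat_arcs as, depot, cs, quotient_of b)"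
    interpret scaled_instance T len depot clients bound vs "scaled (rat_arcs as)" "denom (rat_arcs as)"
      using scaled_instance_rat_arcs[OF inst(1) vs as] .
    have bound: "0 < snd (quotient_of b)" "bound = fst (quotient_of b) / snd (quotient_of b)"
      using b real_of_quotient by (auto simp: quotient_of_denom_pos')
    have routes: "routes ?i = solution cs (fst (quotient_of b)) (snd (quotient_of b))"
      unfolding routes_def solution_def[OF cs bound] path_def[abs_def]
      by (simp add: case_prod_unfold)
    show ?thesis
    proof (intro exI[of _ ?i] conjI)
      show "x = enc_input ?i"
        unfolding x by (simp add: enc_rat_arcs enc_rat)
      show "feasible (routes ?i)" "length (routes ?i) \<le> 2 * opt"
        unfolding routes by (rule solution_feasible[OF cs bound] solution_opt[OF cs bound])+
    qed
  qed
  have "polytime_on P {x. \<exists>T len depot clients bound.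
      school_bus_tree T len depot clients bound \<and> encodes_instance T len depot clients bound x}"
    unfolding polytime_on_def
  proof (intro exI[of _ q] ballI)
    fix x
    assume "x \<in> {x. \<exists>T len depot clients bound.
      school_bus_tree T len depot clients bound \<and> encodes_instance T len depot clients bound x}"
    then obtain i where "x = enc_input i"
      using solved by blast
    then show "\<exists>y t. runs_in P x y t \<and> t \<le> poly q (vsize x)"
      using P by blast
  qed
  moreover have "\<exists>ps. computes P x (enc_solution ps) \<and>
      school_bus_tree.feasible T len depot clients bound ps \<and>
      length ps \<le> 2 * school_bus_tree.opt T len depot clients bound"
    if "school_bus_tree T len depot clients bound" "encodes_instance T len depot clients bound x"
    for T len depot clients bound x
    using solved[OF that] P unfolding computes_def enc_solution_def by blast
  ultimately show ?thesis
    by blast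
qed

end
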